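(* Let $n\ge2$ and let $w$ be a fully commutative element of $W(B_n)$. Then $w$ is non-cancellable (in $W(B_n)$) if and only if $w$ is equal to either a product of commuting generators, $s_1s_2u$, or $s_2s_1u$, where $u$ is a product of commuting generators with $s_1,s_2,s_3\notin\mathrm{supp}(u)$. Analogously, a fully commutative element $w$ of $W(B'_n)$ is non-cancellable (in $W(B'_n)$) if and only if $w$ is equal to either a product of commuting generators, $s_{n+1}s_nu$, or $s_ns_{n+1}u$, where $u$ is a product of commuting generators with $s_{n+1},s_n,s_{n-1}\notin\mathrm{supp}(u)$.
   Context: $W(B_n)$ is the Coxeter group with generators $s_1,\dots,s_n$, $m(s_1,s_2)=4$, $m(s_i,s_{i+1})=3$ for $2\le i<n$, and $m(s_i,s_j)=2$ for $|i-j|\ge2$. $W(B'_n)$ is the Coxeter group with generators $s_2,\dots,s_{n+1}$, $m(s_n,s_{n+1})=4$, $m(s_i,s_{i+1})=3$ for $2\le i<n$, $m(s_i,s_j)=2$ for $|i-j|\ge2$. $\ell$ is length, $\mathcal{L}(w)$, $\mathcal{R}(w)$ the left/right descent sets, $\mathrm{supp}(w)$ the set of generators appearing in a reduced expression of $w$. An element is fully commutative if any two of its reduced expressions are related by moves $st\mapsto ts$ with $m(s,t)=2$. A fully commutative $w$ is left weak star reducible by $s$ with respect to $t$ if $m(s,t)\ge3$, $s\in\mathcal{L}(w)$, $t\in\mathcal{L}(sw)$, and $tw$ is not fully commutative; right weak star reducible is defined symmetrically with right descent sets and $wt$. A fully commutative element is non-cancellable if it is neither left nor right weak star reducible by any $s$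 with respect to any $t$. *)

theory Defs
  imports "HOL-Algebra.Group"
begin

text \<open>
  A Coxeter system is given by its set of generators and its Coxeter matrix. All bonds are finite
  (there is no encoding of a bond \<open>\<infinity>\<close>), which covers the types \<open>B\<^sub>n\<close> and \<open>B'\<^sub>n\<close>.
\<close>

record 'a coxeter =
  gens :: "'a set"
  bond :: "'a \<Rightarrow> 'a \<Rightarrow> nat"

definition coxeter_matrix :: "'a coxeter \<Rightarrow> bool" where
  "coxeter_matrix C \<longleftrightarrow>
     (\<forall>s\<in>gens C. \<forall>t\<in>gens C. bond C s t = bond C t s \<and> 1 \<le> bond C s t \<and>
        (bond C s t = 1 \<longleftrightarrow> s = t))"


subsection \<open>The group presented by a Coxeter matrix\<close>

text \<open>
  The group with generators \<open>gens C\<close> and relations \<open>(s t)\<^bsup>m(s,t)\<^esup> = 1\<close>, as the quotient of the free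
  monoid on \<open>gens C\<close>. The relations with \<open>s = t\<close> read \<open>s s = 1\<close>, so no formal inverses of the
  generators are needed and the quotient monoid is the presented group.
\<close>

inductive word_eq :: "'a coxeter \<Rightarrow> 'a list \<Rightarrow> 'a list \<Rightarrow> bool" for C where
  refl: "xs \<in> lists (gens C) \<Longrightarrow> word_eq C xs xs"
| sym: "word_eq C xs ys \<Longrightarrow> word_eq C ys xs"
| trans: "word_eq C xs ys \<Longrightarrow> word_eq C ys zs \<Longrightarrow> word_eq C xs zs"
| relator: "xs \<in> lists (gens C) \<Longrightarrow> ys \<in> lists (gens C) \<Longrightarrow> s \<in> gens C \<Longrightarrow> t \<in> gens C \<Longrightarrow>
    word_eq C (xs @ concat (replicate (bond C s t) [s, t]) @ ys) (xs @ ys)"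

definition word_rel :: "'a coxeter \<Rightarrow> ('a list \<times> 'a list) set" where
  "word_rel C = {(xs, ys). word_eq C xs ys}"

definition word_elt :: "'a coxeter \<Rightarrow> 'a list \<Rightarrow> 'a list set" where
  "word_elt C xs = word_rel C `` {xs}"

definition cox_group :: "'a coxeter \<Rightarrow> 'a list set monoid" where
  "cox_group C = \<lparr>carrier = lists (gens C) // word_rel C,
     monoid.mult = (\<lambda>X Y. \<Union>x\<in>X. \<Union>y\<in>Y. word_elt C (x @ y)),
     one = word_elt C []\<rparr>"

definition gen :: "'a coxeter \<Rightarrow> 'a \<Rightarrow> 'a list set" where
  "gen C s = word_elt C [s]"

lemma word_eq_lists:
  assumes "word_eq C xs ys"
  shows "xs \<in> lists (gens C)" "ys \<in> lists (gens C)"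
proof -
  have "set xs \<subseteq> gens C \<and> set ys \<subseteq> gens C"
    using assms by (induction) auto
  then show "xs \<in> lists (gens C)" "ys \<in> lists (gens C)"
    by auto
qed

lemma equiv_word_rel: "equiv (lists (gens C)) (word_rel C)"
proof (rule equivI)
  show "word_rel C \<subseteq> lists (gens C) \<times> lists (gens C)"
    unfolding word_rel_def using word_eq_lists by blast
  show "refl_on (lists (gens C)) (word_rel C)"
    by (rule refl_onI) (simp add: word_rel_def word_eq.refl del: in_lists_conv_set)
  show "Relation.sym (word_rel C)"
    by (rule symI) (simp add: word_rel_def word_eq.sym)
  show "Relation.trans (word_rel C)"
    by (rule transI) (unfold word_rel_def mem_Collect_eq case_prod_conv, rule word_eq.trans)
qed

lemma word_eq_append:
  assumes "word_eq C xs xs'" "word_eq C ys ys'"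
  shows "word_eq C (xs @ ys) (xs' @ ys')"
proof -
  have right: "word_eq C (us @ zs) (vs @ zs)"
    if "word_eq C us vs" "zs \<in> lists (gens C)" for us vs zs
    using that
  proof (induction)
    case (relator us vs s t)
    then show ?case
      using word_eq.relator[of us C "vs @ zs" s t] by simp
  next
    case (refl us)
    then show ?case
      by (auto intro!: word_eq.refl)
  next
    case (sym us vs)
    then show ?case
      by (simp add: word_eq.sym)
  next
    case (trans us vs ws)
    show ?case
      using trans.IH(1)[OF trans.prems] trans.IH(2)[OF trans.prems] by (rule word_eq.trans)
  qed
  have left: "word_eq C (zs @ us) (zs @ vs)"
    if "word_eq C us vs" "zs \<in> lists (gens C)" for us vs zs
    using that
  proof (induction)
    case (relator us vs s t)
    then show ?case
      using word_eq.relator[of "zs @ us" C vs s t] by simp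
  next
    case (refl us)
    then show ?case
      by (auto intro!: word_eq.refl)
  next
    case (sym us vs)
    then show ?case
      by (simp add: word_eq.sym)
  next
    case (trans us vs ws)
    show ?case
      using trans.IH(1)[OF trans.prems] trans.IH(2)[OF trans.prems] by (rule word_eq.trans)
  qed
  show ?thesis
    using right[OF assms(1) word_eq_lists(1)[OF assms(2)]]
      left[OF assms(2) word_eq_lists(2)[OF assms(1)]]
    by (rule word_eq.trans)
qed

lemma word_elt_eq_iff:
  assumes "xs \<in> lists (gens C)" "ys \<in> lists (gens C)"
  shows "word_elt C xs = word_elt C ys \<longleftrightarrow> word_eq C xs ys"
  unfolding word_elt_def using eq_equiv_class_iff[OF equiv_word_rel assms]
  by (simp add: word_rel_def)

lemma carrier_cox_group: "carrier (cox_group C) = word_elt C ` lists (gens C)"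
  by (auto simp: cox_group_def quotient_def word_elt_def)

lemma one_cox_group: "\<one>\<^bsub>cox_group C\<^esub> = word_elt C []"
  by (simp add: cox_group_def)

lemma mult_word_elt:
  assumes "xs \<in> lists (gens C)" "ys \<in> lists (gens C)"
  shows "word_elt C xs \<otimes>\<^bsub>cox_group C\<^esub> word_elt C ys = word_elt C (xs @ ys)"
proof -
  have "word_elt C (x @ y) = word_elt C (xs @ ys)"
    if "x \<in> word_elt C xs" "y \<in> word_elt C ys" for x y
  proof -
    from that have "word_eq C (xs @ ys) (x @ y)"
      by (auto simp: word_elt_def word_rel_def intro: word_eq_append)
    then show ?thesis
      using word_elt_eq_iff[OF word_eq_lists, of C "xs @ ys" "x @ y" "xs @ ys" "x @ y"] by simp
  qed
  moreover have "xs \<in> word_elt C xs" "ys \<in> word_elt C ys"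
    using word_eq.refl[OF assms(1)] word_eq.refl[OF assms(2)]
    by (simp_all add: word_elt_def word_rel_def)
  ultimately have "(\<Union>x\<in>word_elt C xs. \<Union>y\<in>word_elt C ys. word_elt C (x @ y)) = word_elt C (xs @ ys)"
    by blast
  then show ?thesis
    by (simp add: cox_group_def)
qed

lemma word_eq_rev:
  assumes "coxeter_matrix C" "xs \<in> lists (gens C)"
  shows "word_eq C (rev xs @ xs) []"
  using assms(2)
proof (induction xs)
  case Nil
  show ?case by (simp add: word_eq.refl)
next
  case (Cons s xs)
  have "bond C s s = 1"
    using assms(1) Cons.hyps by (auto simp: coxeter_matrix_def)
  moreover have "rev xs \<in> lists (gens C)"
    using Cons.hyps by auto
  ultimately have "word_eq C (rev xs @ [s, s] @ xs) (rev xs @ xs)"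
    using word_eq.relator[of "rev xs" C xs s s] Cons.hyps by simp
  then have "word_eq C (rev xs @ [s, s] @ xs) []"
    using Cons.IH by (rule word_eq.trans)
  then show ?case
    by simp
qed

theorem group_cox_group:
  assumes "coxeter_matrix C"
  shows "group (cox_group C)"
proof (rule groupI)
  show "\<one>\<^bsub>cox_group C\<^esub> \<in> carrier (cox_group C)"
    by (auto simp: one_cox_group carrier_cox_group)
next
  fix x y
  assume "x \<in> carrier (cox_group C)" "y \<in> carrier (cox_group C)"
  then obtain xs ys where xs: "xs \<in> lists (gens C)" "x = word_elt C xs"
    and ys: "ys \<in> lists (gens C)" "y = word_elt C ys"
    by (auto simp: carrier_cox_group)
  then show "x \<otimes>\<^bsub>cox_group C\<^esub> y \<in> carrier (cox_group C)"
    using mult_word_elt[OF xs(1) ys(1)] by (auto simp: carrier_cox_group)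
next
  fix x y z
  assume "x \<in> carrier (cox_group C)" "y \<in> carrier (cox_group C)" "z \<in> carrier (cox_group C)"
  then obtain xs ys zs where "xs \<in> lists (gens C)" "x = word_elt C xs"
    "ys \<in> lists (gens C)" "y = word_elt C ys" "zs \<in> lists (gens C)" "z = word_elt C zs"
    by (auto simp: carrier_cox_group)
  then show "x \<otimes>\<^bsub>cox_group C\<^esub> y \<otimes>\<^bsub>cox_group C\<^esub> z = x \<otimes>\<^bsub>cox_group C\<^esub> (y \<otimes>\<^bsub>cox_group C\<^esub> z)"
    using mult_word_elt[of xs C ys] mult_word_elt[of ys C zs]
      mult_word_elt[of "xs @ ys" C zs] mult_word_elt[of xs C "ys @ zs"]
    by auto
next
  fix x
  assume "x \<in> carrier (cox_group C)"
  then obtain xs where xs: "xs \<in> lists (gens C)" "x = word_elt C xs"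
    by (auto simp: carrier_cox_group)
  show "\<one>\<^bsub>cox_group C\<^esub> \<otimes>\<^bsub>cox_group C\<^esub> x = x"
    using xs mult_word_elt[of "[]" C xs] by (simp add: one_cox_group)
  have rev: "rev xs \<in> lists (gens C)"
    using xs(1) by auto
  then have "word_elt C (rev xs) \<otimes>\<^bsub>cox_group C\<^esub> x = \<one>\<^bsub>cox_group C\<^esub>"
    using xs mult_word_elt[OF rev xs(1)] word_eq_rev[OF assms xs(1)]
      word_elt_eq_iff[of "rev xs @ xs" C "[]"]
    by (auto simp: one_cox_group)
  then show "\<exists>y\<in>carrier (cox_group C). y \<otimes>\<^bsub>cox_group C\<^esub> x = \<one>\<^bsub>cox_group C\<^esub>"
    using rev by (auto simp: carrier_cox_group)
qed


subsection \<open>Length, descents, support\<close>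

definition len :: "'a coxeter \<Rightarrow> 'a list set \<Rightarrow> nat" where
  "len C w = (LEAST k. \<exists>xs\<in>lists (gens C). word_elt C xs = w \<and> length xs = k)"

definition reduced_expr :: "'a coxeter \<Rightarrow> 'a list set \<Rightarrow> 'a list \<Rightarrow> bool" where
  "reduced_expr C w xs \<longleftrightarrow> xs \<in> lists (gens C) \<and> word_elt C xs = w \<and> length xs = len C w"

definition left_descents :: "'a coxeter \<Rightarrow> 'a list set \<Rightarrow> 'a set" where
  "left_descents C w = {s \<in> gens C. len C (gen C s \<otimes>\<^bsub>cox_group C\<^esub> w) < len C w}"

definition right_descents :: "'a coxeter \<Rightarrow> 'a list set \<Rightarrow> 'a set" where
  "right_descents C w = {s \<in> gens C. len C (w \<otimes>\<^bsub>cox_group C\<^esub> gen C s) < len C w}"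

definition supp :: "'a coxeter \<Rightarrow> 'a list set \<Rightarrow> 'a set" where
  "supp C w = {s. \<exists>xs. reduced_expr C w xs \<and> s \<in> set xs}"


subsection \<open>Full commutativity and weak star reducibility\<close>

inductive comm_move :: "'a coxeter \<Rightarrow> 'a list \<Rightarrow> 'a list \<Rightarrow> bool" for C where
  "bond C s t = 2 \<Longrightarrow> comm_move C (xs @ [s, t] @ ys) (xs @ [t, s] @ ys)"

definition fully_commutative :: "'a coxeter \<Rightarrow> 'a list set \<Rightarrow> bool" where
  "fully_commutative C w \<longleftrightarrow> w \<in> carrier (cox_group C) \<and>
     (\<forall>xs ys. reduced_expr C w xs \<longrightarrow> reduced_expr C w ys \<longrightarrow> (comm_move C)\<^sup>*\<^sup>* xs ys)"

definition left_weak_star_reducible ::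
    "'a coxeter \<Rightarrow> 'a list set \<Rightarrow> 'a \<Rightarrow> 'a \<Rightarrow> bool" where
  "left_weak_star_reducible C w s t \<longleftrightarrow>
     fully_commutative C w \<and> s \<in> gens C \<and> t \<in> gens C \<and> bond C s t \<ge> 3 \<and>
     s \<in> left_descents C w \<and>
     t \<in> left_descents C (gen C s \<otimes>\<^bsub>cox_group C\<^esub> w) \<and>
     \<not> fully_commutative C (gen C t \<otimes>\<^bsub>cox_group C\<^esub> w)"

definition right_weak_star_reducible ::
    "'a coxeter \<Rightarrow> 'a list set \<Rightarrow> 'a \<Rightarrow> 'a \<Rightarrow> bool" where
  "right_weak_star_reducible C w s t \<longleftrightarrow>
     fully_commutative C w \<and> s \<in> gens C \<and> t \<in> gens C \<and> bond C s t \<ge> 3 \<and>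
     s \<in> right_descents C w \<and>
     t \<in> right_descents C (w \<otimes>\<^bsub>cox_group C\<^esub> gen C s) \<and>
     \<not> fully_commutative C (w \<otimes>\<^bsub>cox_group C\<^esub> gen C t)"

definition non_cancellable :: "'a coxeter \<Rightarrow> 'a list set \<Rightarrow> bool" where
  "non_cancellable C w \<longleftrightarrow> fully_commutative C w \<and>
     (\<forall>s\<in>gens C. \<forall>t\<in>gens C.
        \<not> left_weak_star_reducible C w s t \<and> \<not> right_weak_star_reducible C w s t)"

text \<open>
  Products of distinct, pairwise commuting generators; the empty product (the identity) is included.
\<close>

definition commuting_product :: "'a coxeter \<Rightarrow> 'a list set \<Rightarrow> bool" where
  "commuting_product C w \<longleftrightarrow>
     (\<exists>xs\<in>lists (gens C). distinct xs \<and>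
        (\<forall>s\<in>set xs. \<forall>t\<in>set xs.
           gen C s \<otimes>\<^bsub>cox_group C\<^esub> gen C t = gen C t \<otimes>\<^bsub>cox_group C\<^esub> gen C s) \<and>
        w = word_elt C xs)"


subsection \<open>Types \<open>B\<^sub>n\<close> and \<open>B'\<^sub>n\<close>\<close>

definition typeB :: "nat \<Rightarrow> nat coxeter" where
  "typeB n = \<lparr>gens = {1..n},
     bond = (\<lambda>i j. if i = j then 1
                   else if {i, j} = {1, 2} then 4
                   else if j = i + 1 \<or> i = j + 1 then 3
                   else 2)\<rparr>"

definition typeB' :: "nat \<Rightarrow> nat coxeter" where
  "typeB' n = \<lparr>gens = {2..n + 1},
     bond = (\<lambda>i j. if i = j then 1
                   else if {i, j} = {n, n + 1} then 4
                   else if j = i + 1 \<or> i = j + 1 then 3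
                   else 2)\<rparr>"

lemma coxeter_matrix_typeB: "coxeter_matrix (typeB n)"
  by (auto simp: coxeter_matrix_def typeB_def insert_commute)

lemma coxeter_matrix_typeB': "coxeter_matrix (typeB' n)"
  by (auto simp: coxeter_matrix_def typeB'_def insert_commute)

end

theory Submission
  imports Defs "HOL-Library.Multiset" "HOL-Library.Sublist"
begin

text \<open>
  Commutations preserve the subword of letters \<open>s, t\<close> with \<open>m(s, t) \<ge> 3\<close>. So if a reduced word of a
  fully commutative \<open>w\<close> starts with \<open>s t\<close>, \<open>m(s, t) = 3\<close>, or with \<open>s t s\<close>, \<open>m(s, t) = 4\<close>, then
  \<open>t w\<close> is longer than \<open>w\<close> and admits a braid move, and \<open>w\<close> is left reducible. For non-cancellable
  \<open>w\<close> the commutation class therefore has neither braid factors nor such prefixes and suffixes. In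
  type \<open>B\<close> this forces both \<open>i - 1\<close> and \<open>i + 1\<close> to occur between consecutive letters \<open>i \<ge> 2\<close>. If
  \<open>i\<close> and \<open>i + 1\<close> with \<open>i \<ge> 2\<close> were both in the support, take the largest such \<open>b = i + 1\<close>; up to
  reversal, \<open>b - 1\<close> occurs before \<open>b\<close>, the missing prefixes give a chain \<open>1, 2, \<dots>, b\<close> of first
  occurrences, each of these letters occurs only once, and the word can be made to end in
  \<open>(b - 1) b\<close>, a contradiction.

  Conversely, for \<open>w = s\<^sub>1 s\<^sub>2 u\<close> the only candidate for a reduction is \<open>s = s\<^sub>1\<close>, \<open>t = s\<^sub>2\<close>, and
  \<open>t w = s\<^sub>2 s\<^sub>1 s\<^sub>2 u\<close> is fully commutative: by the exchange condition its reduced words have the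
  letters of \<open>w\<close>, and the parity of the number of letters \<open>s\<^sub>1\<close> is an invariant.
\<close>

section \<open>Commutation classes of words\<close>

lemma comm_moves_context:
  assumes "(comm_move C)\<^sup>*\<^sup>* xs ys"
  shows "(comm_move C)\<^sup>*\<^sup>* (us @ xs @ vs) (us @ ys @ vs)"
  using assms
proof (induction)
  case (step ys zs)
  from step.hyps(2) have "comm_move C (us @ ys @ vs) (us @ zs @ vs)"
  proof cases
    case (1 s t as bs)
    then show ?thesis
      using comm_move.intros[of C s t "us @ as" "bs @ vs"] by simp
  qed
  with step.IH show ?case
    by (rule rtranclp.rtrancl_into_rtrancl)
qed simp

lemma comm_moves_mset:
  assumes "(comm_move C)\<^sup>*\<^sup>* xs ys"
  shows "mset xs = mset ys"
  using assms by (induction) (auto elim: comm_move.cases)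

text \<open>A swap changes this subword only if it exchanges \<open>s\<close> with \<open>t\<close>,
  which the two bond conditions rule out; symmetry of \<open>bond\<close> is not assumed here, hence
  both orders.\<close>

lemma comm_moves_filter:
  assumes "(comm_move C)\<^sup>*\<^sup>* xs ys" "bond C s t \<noteq> 2" "bond C t s \<noteq> 2"
  shows "filter (\<lambda>x. x = s \<or> x = t) xs = filter (\<lambda>x. x = s \<or> x = t) ys"
  using assms(1)
proof (induction)
  case (step ys zs)
  from step.hyps(2) have "filter (\<lambda>x. x = s \<or> x = t) ys = filter (\<lambda>x. x = s \<or> x = t) zs"
    by cases (use assms(2,3) in auto)
  with step.IH show ?case
    by simp
qed simp

lemma comm_moves_right:
  assumes "\<forall>x\<in>set xs. bond C s x = 2"
  shows "(comm_move C)\<^sup>*\<^sup>* (s # xs) (xs @ [s])"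
  using assms
proof (induction xs)
  case (Cons x xs)
  have "comm_move C (s # x # xs) (x # s # xs)"
    using comm_move.intros[of C s x "[]" xs] Cons.prems by simp
  moreover have "(comm_move C)\<^sup>*\<^sup>* (x # s # xs) (x # xs @ [s])"
    using comm_moves_context[of C "s # xs" "xs @ [s]" "[x]" "[]"] Cons by simp
  ultimately show ?case
    by simp
qed simp

lemma comm_moves_left:
  assumes "\<forall>x\<in>set xs. bond C x s = 2"
  shows "(comm_move C)\<^sup>*\<^sup>* (xs @ [s]) (s # xs)"
  using assms
proof (induction xs)
  case (Cons x xs)
  have "comm_move C (x # s # xs) (s # x # xs)"
    using comm_move.intros[of C x s "[]" xs] Cons.prems by simp
  moreover have "(comm_move C)\<^sup>*\<^sup>* (x # xs @ [s]) (x # s # xs)"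
    using comm_moves_context[of C "xs @ [s]" "s # xs" "[x]" "[]"] Cons by simp
  ultimately show ?case
    by (simp add: rtranclp.rtrancl_into_rtrancl)
qed simp

text \<open>Stable sorting by commutations: a head letter outside \<open>P\<close> travels right
  across the letters satisfying \<open>P\<close>.\<close>

lemma comm_moves_partition:
  assumes "\<forall>x\<in>set xs. \<forall>y\<in>set xs. P x \<longrightarrow> \<not> P y \<longrightarrow> bond C y x = 2"
  shows "(comm_move C)\<^sup>*\<^sup>* xs (filter P xs @ filter (\<lambda>x. \<not> P x) xs)"
  using assms
proof (induction xs)
  case (Cons x xs)
  then have "(comm_move C)\<^sup>*\<^sup>* xs (filter P xs @ filter (\<lambda>x. \<not> P x) xs)"
    by simp
  then have 1: "(comm_move C)\<^sup>*\<^sup>* (x # xs) (x # filter P xs @ filter (\<lambda>x. \<not> P x) xs)"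
    using comm_moves_context[of C xs _ "[x]" "[]"] by fastforce
  show ?case
  proof (cases "P x")
    case False
    then have "(comm_move C)\<^sup>*\<^sup>* (x # filter P xs) (filter P xs @ [x])"
      using Cons.prems by (intro comm_moves_right) auto
    then have "(comm_move C)\<^sup>*\<^sup>* (x # filter P xs @ filter (\<lambda>x. \<not> P x) xs)
        (filter P xs @ x # filter (\<lambda>x. \<not> P x) xs)"
      using comm_moves_context[of C "x # filter P xs" "filter P xs @ [x]" "[]"] by fastforce
    with 1 False show ?thesis
      by simp
  qed (use 1 in simp)
qed simp

lemma comm_moves_permute:
  assumes "mset xs = mset ys" "distinct xs"
    and "\<forall>x\<in>set xs. \<forall>y\<in>set xs. x \<noteq> y \<longrightarrow> bond C x y = 2"
  shows "(comm_move C)\<^sup>*\<^sup>* xs ys"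
  using assms
proof (induction ys arbitrary: xs)
  case (Cons y ys)
  then have "y \<in> set xs"
    by (metis list.set_intros(1) mset_eq_setD)
  then obtain as bs where xs: "xs = as @ y # bs"
    by (meson split_list)
  have "(comm_move C)\<^sup>*\<^sup>* (as @ [y]) (y # as)"
    using Cons.prems(2,3) xs by (intro comm_moves_left) auto
  then have "(comm_move C)\<^sup>*\<^sup>* xs (y # as @ bs)"
    using comm_moves_context[of C "as @ [y]" "y # as" "[]" bs] xs by simp
  moreover have "(comm_move C)\<^sup>*\<^sup>* (as @ bs) ys"
    using Cons.prems xs by (intro Cons.IH) auto
  then have "(comm_move C)\<^sup>*\<^sup>* (y # as @ bs) (y # ys)"
    using comm_moves_context[of C "as @ bs" ys "[y]" "[]"] by simp
  ultimately show ?case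
    by simp
qed simp

lemma subseq_set_subset: "subseq xs ys \<Longrightarrow> set xs \<subseteq> set ys"
  by (auto simp: subseq_conv_nths dest: in_set_nthsD)

lemma subseq_Cons_cases:
  "subseq xs (y # ys) \<Longrightarrow> subseq xs ys \<or> (\<exists>zs. xs = y # zs \<and> subseq zs ys)"
  by (cases xs) (auto split: if_splits)

section \<open>Reduced words and the exchange condition\<close>

text \<open>Reducedness as a property of words, independent of \<open>len\<close>;
  \<open>reduced_expr_iff\<close> links it to the reduced expressions of an element.\<close>

definition reduced :: "'a coxeter \<Rightarrow> 'a list \<Rightarrow> bool" where
  "reduced C xs \<longleftrightarrow> set xs \<subseteq> gens C \<and> (\<forall>ys. word_eq C xs ys \<longrightarrow> length xs \<le> length ys)"

text \<open>
  The parity of the number of factorizations \<open>xs = as @ b # bs\<close> for which the reflection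
  \<open>as b as\<^sup>-\<^sup>1\<close> is represented by the word \<open>v\<close>.
\<close>

fun inv_parity :: "'a coxeter \<Rightarrow> 'a list \<Rightarrow> 'a list \<Rightarrow> bool" where
  "inv_parity C [] v = False"
| "inv_parity C (s # xs) v = (word_eq C v [s] \<noteq> inv_parity C xs (s # v @ [s]))"

text \<open>Cocycle identity for the inversion count: passing the prefix \<open>xs\<close>
  conjugates the tested reflection by it.\<close>

lemma inv_parity_append:
  "inv_parity C (xs @ ys) v = (inv_parity C xs v \<noteq> inv_parity C ys (rev xs @ v @ xs))"
  by (induction xs arbitrary: v) auto

locale coxeter_system =
  fixes C :: "'a coxeter"
  assumes coxeter_matrix: "coxeter_matrix C"
begin

abbreviation weq (infix "\<approx>" 50) where "xs \<approx> ys \<equiv> word_eq C xs ys"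
abbreviation comms (infix "\<leadsto>" 50) where "xs \<leadsto> ys \<equiv> (comm_move C)\<^sup>*\<^sup>* xs ys"

lemma bond_sym: "s \<in> gens C \<Longrightarrow> t \<in> gens C \<Longrightarrow> bond C s t = bond C t s"
  and bond_refl: "s \<in> gens C \<Longrightarrow> bond C s s = 1"
  using coxeter_matrix by (auto simp: coxeter_matrix_def)

lemma weq_refl: "set xs \<subseteq> gens C \<Longrightarrow> xs \<approx> xs"
  by (auto intro: word_eq.refl)

lemma weq_gens:
  assumes "xs \<approx> ys"
  shows "set xs \<subseteq> gens C" "set ys \<subseteq> gens C"
  using word_eq_lists[OF assms] by auto

lemmas weq_sym = word_eq.sym[of C]
lemmas weq_trans[trans] = word_eq.trans[of C]

section \<open>Calculus with words representing the same element\<close>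

lemma weq_context:
  assumes "xs \<approx> ys" "set us \<subseteq> gens C" "set vs \<subseteq> gens C"
  shows "us @ xs @ vs \<approx> us @ ys @ vs"
  using assms by (intro word_eq_append weq_refl)

lemma weq_rev_self: "set xs \<subseteq> gens C \<Longrightarrow> rev xs @ xs \<approx> []" "set xs \<subseteq> gens C \<Longrightarrow> xs @ rev xs \<approx> []"
  using word_eq_rev[OF coxeter_matrix, of xs] word_eq_rev[OF coxeter_matrix, of "rev xs"]
  by (auto simp: in_lists_conv_set)

lemma weq_cancel_rev:
  assumes "set xs \<subseteq> gens C" "set us \<subseteq> gens C" "set vs \<subseteq> gens C"
  shows "us @ xs @ rev xs @ vs \<approx> us @ vs"
  using weq_context[OF weq_rev_self(2)[OF assms(1)] assms(2,3)] by simp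

lemma weq_cancel:
  assumes "s \<in> gens C" "set us \<subseteq> gens C" "set vs \<subseteq> gens C"
  shows "us @ s # s # vs \<approx> us @ vs"
  using weq_cancel_rev[of "[s]"] assms by simp

lemma weq_mult_left_iff:
  assumes "s \<in> gens C" "set xs \<subseteq> gens C"
  shows "s # xs \<approx> ys \<longleftrightarrow> xs \<approx> s # ys"
proof -
  have *: "us \<approx> s # vs" if "s # us \<approx> vs" "set us \<subseteq> gens C" for us vs
  proof -
    have "us \<approx> s # s # us"
      using weq_cancel[of s "[]" us] that assms by (auto intro: weq_sym)
    also have "s # s # us \<approx> s # vs"
      using weq_context[OF that(1), of "[s]" "[]"] assms by simp
    finally show ?thesis .
  qed
  show ?thesis
  proof
    assume "xs \<approx> s # ys"
    then have "s # ys \<approx> xs" "set ys \<subseteq> gens C"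
      using weq_gens(2)[of xs "s # ys"] weq_sym by auto
    then show "s # xs \<approx> ys"
      using *[of ys xs] weq_sym by blast
  qed (use *[of xs ys] assms in blast)
qed

lemma weq_rev_move:
  assumes "xs @ ys \<approx> zs"
  shows "xs \<approx> zs @ rev ys"
proof -
  have g: "set xs \<subseteq> gens C" "set ys \<subseteq> gens C"
    using weq_gens[OF assms] by auto
  have "xs \<approx> xs @ ys @ rev ys"
    using weq_cancel_rev[of ys xs "[]"] g by (auto intro: weq_sym)
  also have "xs @ ys @ rev ys \<approx> zs @ rev ys"
    using weq_context[OF assms, of "[]" "rev ys"] g by simp
  finally show ?thesis .
qed

text \<open>Reversal inverts the element and turns the relator of \<open>s, t\<close> into that of
  \<open>t, s\<close>, again a relator by symmetry of the bonds.\<close>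

lemma weq_rev:
  assumes "xs \<approx> ys"
  shows "rev xs \<approx> rev ys"
  using assms
proof (induction)
  case (relator xs ys s t)
  have "rev (concat (replicate m [s, t])) = concat (replicate m [t, s])" for m
    by (simp add: rev_concat)
  then show ?case
    using word_eq.relator[of "rev ys" C "rev xs" t s] relator bond_sym[of s t]
    by (simp add: in_lists_conv_set)
qed (auto intro: word_eq.intros simp: weq_refl)

lemma braid_weq:
  assumes "s \<in> gens C" "t \<in> gens C"
  shows "bond C s t = 2 \<Longrightarrow> [s, t] \<approx> [t, s]"
    and "bond C s t = 3 \<Longrightarrow> [s, t, s] \<approx> [t, s, t]"
    and "bond C s t = 4 \<Longrightarrow> [s, t, s, t] \<approx> [t, s, t, s]"
proof -
  have *: "concat (replicate (bond C s t) [s, t]) \<approx> []"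
    using word_eq.relator[of "[]" C "[]" s t] assms by simp
  show "bond C s t = 2 \<Longrightarrow> [s, t] \<approx> [t, s]"
    using * weq_rev_move[of "[s, t]" "[s, t]" "[]"] by (simp add: numeral_eq_Suc)
  show "bond C s t = 3 \<Longrightarrow> [s, t, s] \<approx> [t, s, t]"
    using * weq_rev_move[of "[s, t, s]" "[t, s, t]" "[]"] by (simp add: numeral_eq_Suc)
  show "bond C s t = 4 \<Longrightarrow> [s, t, s, t] \<approx> [t, s, t, s]"
    using * weq_rev_move[of "[s, t, s, t]" "[s, t, s, t]" "[]"] by (simp add: numeral_eq_Suc)
qed

lemma comms_weq:
  assumes "xs \<leadsto> ys" "set xs \<subseteq> gens C"
  shows "xs \<approx> ys"
  using assms(1)
proof (induction)
  case (step ys zs)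
  from step.hyps(2) have "ys \<approx> zs"
  proof cases
    case (1 s t us vs)
    then have "set (us @ [s, t] @ vs) \<subseteq> gens C"
      using weq_gens(2)[OF step.IH] by simp
    then show ?thesis
      unfolding 1 by (intro weq_context braid_weq 1) auto
  qed
  with step.IH show ?case
    by (rule weq_trans)
qed (use assms(2) weq_refl in simp)

text \<open>Inserting a relator adds \<open>m(s, t)\<close> times the number of letters in
  \<open>[s, t]\<close> satisfying \<open>P\<close>. This is even if both or neither do, and by the
  assumption if exactly one does.\<close>

lemma weq_parity:
  assumes "xs \<approx> ys" "\<And>s t. s \<in> gens C \<Longrightarrow> t \<in> gens C \<Longrightarrow> P s \<Longrightarrow> \<not> P t \<Longrightarrow> even (bond C s t)"
  shows "even (length (filter P xs)) \<longleftrightarrow> even (length (filter P ys))"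
  using assms(1)
proof (induction)
  case (relator xs ys s t)
  have "length (filter P (concat (replicate m [s, t]))) = m * length (filter P [s, t])" for m
    by (induction m) auto
  moreover have "even (bond C s t * length (filter P [s, t]))"
    using assms(2)[of s t] assms(2)[of t s] bond_sym[of s t] relator by auto
  ultimately show ?case
    by simp
qed auto

lemma weq_even_length: "xs \<approx> ys \<Longrightarrow> even (length xs) \<longleftrightarrow> even (length ys)"
  using weq_parity[of xs ys "\<lambda>_. True"] by simp

section \<open>Reflection parity as an invariant of the element\<close>

lemma inv_parity_cong:
  assumes "v \<approx> v'" "set xs \<subseteq> gens C"
  shows "inv_parity C xs v = inv_parity C xs v'"
  using assms
proof (induction xs arbitrary: v v')
  case (Cons s xs)
  have "s # v @ [s] \<approx> s # v' @ [s]"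
    using weq_context[OF Cons.prems(1), of "[s]" "[s]"] Cons.prems by simp
  then have "inv_parity C xs (s # v @ [s]) = inv_parity C xs (s # v' @ [s])"
    using Cons by simp
  moreover have "v \<approx> [s] \<longleftrightarrow> v' \<approx> [s]"
    using Cons.prems(1) weq_trans weq_sym by blast
  ultimately show ?case
    by simp
qed simp

lemma weq_conj_iff:
  assumes "set us \<subseteq> gens C" "set v \<subseteq> gens C"
  shows "rev us @ v @ us \<approx> r \<longleftrightarrow> v \<approx> us @ r @ rev us"
proof
  assume *: "rev us @ v @ us \<approx> r"
  have "v \<approx> us @ rev us @ v"
    using weq_cancel_rev[of us "[]" v] assms by (auto intro: weq_sym)
  also have "us @ rev us @ v \<approx> us @ rev us @ v @ us @ rev us"
    using weq_cancel_rev[of us "us @ rev us @ v" "[]"] assms by (auto intro: weq_sym)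
  also have "us @ rev us @ v @ us @ rev us \<approx> us @ r @ rev us"
    using weq_context[OF *, of us "rev us"] assms by simp
  finally show "v \<approx> us @ r @ rev us" .
next
  assume *: "v \<approx> us @ r @ rev us"
  have r: "set r \<subseteq> gens C"
    using weq_gens[OF *] by auto
  have "rev us @ v @ us \<approx> rev us @ us @ r @ rev us @ us"
    using weq_context[OF *, of "rev us" us] assms by simp
  also have "rev us @ us @ r @ rev us @ us \<approx> rev us @ us @ r"
    using weq_cancel_rev[of "rev us" "rev us @ us @ r" "[]"] assms r by simp
  also have "rev us @ us @ r \<approx> r"
    using weq_cancel_rev[of "rev us" "[]" r] assms r by simp
  finally show "rev us @ v @ us \<approx> r" .
qed

text \<open>In an alternating word the letter at position \<open>i\<close>, counted from 0, has the
  reflection \<open>(s t)^i s\<close>.\<close>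

lemma inv_parity_alternating:
  assumes "s \<in> gens C" "t \<in> gens C" "set v \<subseteq> gens C"
  shows "inv_parity C (concat (replicate k [s, t])) v \<longleftrightarrow>
    odd (\<Sum>i<2 * k. of_bool (v \<approx> concat (replicate i [s, t]) @ [s]) :: nat)"
  using assms(3)
proof (induction k arbitrary: v)
  case (Suc k)
  \<comment> \<open>Dropping the leading \<open>s t\<close> replaces \<open>v\<close> by a
    conjugate, which shifts the index of the reflections by two.\<close>
  have shift: "[t, s] @ v @ [s, t] \<approx> concat (replicate i [s, t]) @ [s] \<longleftrightarrow>
      v \<approx> concat (replicate (Suc (Suc i)) [s, t]) @ [s]" for i
  proof -
    have "concat (replicate i [s, t]) @ [s, t] = [s, t] @ concat (replicate i [s, t])"
      using arg_cong[OF replicate_append_same[of i "[s, t]"], of concat] by simp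
    then have "concat (replicate (Suc (Suc i)) [s, t]) @ [s] =
        [s, t] @ (concat (replicate i [s, t]) @ [s]) @ rev [s, t]"
      by simp
    then show ?thesis
      using weq_conj_iff[of "[s, t]" v "concat (replicate i [s, t]) @ [s]"] Suc.prems assms
      by (simp only:) simp
  qed
  have 1: "[s] @ v @ [s] \<approx> [t] \<longleftrightarrow> v \<approx> [s, t, s]"
    using weq_conj_iff[of "[s]" v "[t]"] Suc.prems assms by simp
  have "inv_parity C (concat (replicate k [s, t])) ([t, s] @ v @ [s, t]) \<longleftrightarrow>
      odd (\<Sum>i<2 * k. of_bool (v \<approx> concat (replicate (Suc (Suc i)) [s, t]) @ [s]) :: nat)"
    unfolding shift[symmetric] using Suc.prems assms by (intro Suc.IH) auto
  then show ?case
    using 1 by (simp add: sum.lessThan_Suc_shift del: sum.lessThan_Suc)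
qed simp

text \<open>As \<open>(s t)^m = 1\<close>, the \<open>2 m\<close> reflections of the relator repeat
  with period \<open>m\<close>, so every element is counted an even number of times.\<close>

lemma inv_parity_relator:
  assumes "s \<in> gens C" "t \<in> gens C" "set v \<subseteq> gens C"
  shows "\<not> inv_parity C (concat (replicate (bond C s t) [s, t])) v"
proof -
  let ?m = "bond C s t"
  let ?r = "\<lambda>i. concat (replicate i [s, t]) @ [s]"
  have g: "set (concat (replicate i [s, t])) \<subseteq> gens C" for i
    using assms by auto
  have "?r (i + ?m) \<approx> ?r i" for i
    using word_eq.relator[of "concat (replicate i [s, t])" C "[s]" s t] assms g[of i]
    by (simp add: replicate_add subset_iff in_lists_conv_set)
  then have "v \<approx> ?r (i + ?m) \<longleftrightarrow> v \<approx> ?r i" for i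
    using weq_trans weq_sym by blast
  moreover have "(\<Sum>i<m + k. f i) = (\<Sum>i<m. f i) + (\<Sum>i<k. f (i + m))" for m k and f :: "nat \<Rightarrow> nat"
    by (induction k) (auto simp: algebra_simps)
  from this[where m = ?m and k = ?m]
  have "(\<Sum>i<2 * ?m. f i) = (\<Sum>i<?m. f i) + (\<Sum>i<?m. f (i + ?m))" for f :: "nat \<Rightarrow> nat"
    by (simp only: mult_2)
  ultimately show ?thesis
    unfolding inv_parity_alternating[OF assms] by simp
qed

text \<open>In the cocycle identity the inserted relator contributes nothing by
  \<open>inv_parity_relator\<close>, and, being trivial in the group, it does not change the
  reflection tested on the remaining word.\<close>

lemma inv_parity_weq:
  assumes "xs \<approx> ys" "set v \<subseteq> gens C"
  shows "inv_parity C xs v = inv_parity C ys v"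
  using assms
proof (induction arbitrary: v)
  case (relator xs ys s t)
  let ?r = "concat (replicate (bond C s t) [s, t])" and ?v = "rev xs @ v @ xs"
  have g: "set ?r \<subseteq> gens C" "set ?v \<subseteq> gens C"
    using relator by auto
  have r: "?r \<approx> []"
    using word_eq.relator[of "[]" C "[]" s t] relator by simp
  have "rev ?r @ ?v @ ?r \<approx> [] @ ?v @ []"
    using weq_rev[OF r] r g by (intro word_eq_append weq_refl) auto
  then have "inv_parity C ys (rev ?r @ ?v @ ?r) = inv_parity C ys ?v"
    using inv_parity_cong[of "rev ?r @ ?v @ ?r" ?v ys] relator by auto
  then show ?case
    using inv_parity_relator[OF relator(3,4) g(2)] by (simp add: inv_parity_append)
qed auto

text \<open>An odd count is nonzero, so \<open>v\<close> is the reflection \<open>as b as^-1\<close>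
  of some letter \<open>b\<close>; multiplying by it from the left deletes that letter.\<close>

lemma inv_parity_delete:
  assumes "inv_parity C xs v" "set xs \<subseteq> gens C" "set v \<subseteq> gens C"
  shows "\<exists>as b bs. xs = as @ b # bs \<and> v @ xs \<approx> as @ bs"
  using assms
proof (induction xs arbitrary: v)
  case (Cons s xs)
  show ?case
  proof (cases "v \<approx> [s]")
    case True
    have "v @ s # xs \<approx> [s] @ s # xs"
      using word_eq_append[OF True, of "s # xs" "s # xs"] Cons.prems weq_refl by auto
    also have "[s] @ s # xs \<approx> xs"
      using weq_cancel[of s "[]" xs] Cons.prems by simp
    finally show ?thesis
      by (intro exI[of _ "[]"]) auto
  next
    case False
    then obtain as b bs where *: "xs = as @ b # bs" "(s # v @ [s]) @ xs \<approx> as @ bs"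
      using Cons.IH[of "s # v @ [s]"] Cons.prems by auto
    then have "v @ s # xs \<approx> (s # as) @ bs"
      using weq_mult_left_iff[of s "v @ s # xs" "as @ bs"] Cons.prems by auto
    then show ?thesis
      using * by (intro exI[of _ "s # as"]) auto
  qed
qed simp

section \<open>Reduced words, exchange and deletion\<close>

lemma ex_reduced:
  assumes "set xs \<subseteq> gens C"
  shows "\<exists>ys. reduced C ys \<and> xs \<approx> ys"
proof -
  obtain ys where "xs \<approx> ys" "\<forall>zs. xs \<approx> zs \<longrightarrow> length ys \<le> length zs"
    using ex_has_least_nat[of "\<lambda>ys. xs \<approx> ys" xs length] weq_refl[OF assms] by blast
  then show ?thesis
    unfolding reduced_def using weq_gens(2) weq_trans by blast
qed

lemma reduced_weq_length:
  "reduced C xs \<Longrightarrow> reduced C ys \<Longrightarrow> xs \<approx> ys \<Longrightarrow> length xs = length ys"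
  unfolding reduced_def using weq_sym by (meson le_antisym)

lemma reduced_same_length:
  assumes "reduced C xs" "xs \<approx> ys" "length ys \<le> length xs"
  shows "reduced C ys"
  unfolding reduced_def
proof (intro conjI allI impI)
  fix zs
  assume "ys \<approx> zs"
  with assms have "length xs \<le> length zs"
    unfolding reduced_def using weq_trans by blast
  with assms(3) show "length ys \<le> length zs"
    by simp
qed (use assms weq_gens in blast)

lemma reduced_append:
  assumes "reduced C (us @ xs @ vs)"
  shows "reduced C xs"
  unfolding reduced_def
proof (intro conjI allI impI)
  show "set xs \<subseteq> gens C"
    using assms by (simp add: reduced_def)
next
  fix ys
  assume "xs \<approx> ys"
  then have "us @ xs @ vs \<approx> us @ ys @ vs"
    using assms by (intro weq_context) (auto simp: reduced_def)
  then have "length (us @ xs @ vs) \<le> length (us @ ys @ vs)"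
    using assms unfolding reduced_def by blast
  then show "length xs \<le> length ys"
    by simp
qed

lemma reduced_no_square: "\<not> reduced C (us @ s # s # vs)"
proof
  assume *: "reduced C (us @ s # s # vs)"
  then have "us @ s # s # vs \<approx> us @ vs"
    by (intro weq_cancel) (auto simp: reduced_def)
  with * have "length (us @ s # s # vs) \<le> length (us @ vs)"
    unfolding reduced_def by blast
  then show False
    by simp
qed

text \<open>If \<open>s # xs\<close> is not reduced, then \<open>xs\<close> equals
  \<open>s # zs\<close> for some \<open>zs\<close> shorter than \<open>xs\<close>. The reflection
  \<open>s\<close> has odd count in \<open>s # zs\<close>, hence in \<open>xs\<close> by
  \<open>inv_parity_weq\<close>, and \<open>inv_parity_delete\<close> removes a letter.\<close>

lemma exchange:
  assumes "reduced C xs" "s \<in> gens C" "\<not> reduced C (s # xs)"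
  shows "\<exists>as b bs. xs = as @ b # bs \<and> s # xs \<approx> as @ bs"
proof -
  have g: "set xs \<subseteq> gens C"
    using assms by (auto simp: reduced_def)
  with assms obtain zs where zs: "reduced C zs" "s # xs \<approx> zs"
    using ex_reduced[of "s # xs"] by auto
  \<comment> \<open>Word equality preserves the parity of the length, so \<open>zs\<close>, being
    shorter than \<open>s # xs\<close>, is even shorter than \<open>xs\<close>.\<close>
  have "length zs \<noteq> length xs"
    using weq_even_length[OF zs(2)] by auto
  moreover have "length zs < length (s # xs)"
    using reduced_same_length[OF zs(1) weq_sym[OF zs(2)]] assms(3) by (meson linorder_not_less)
  ultimately have len: "length (s # zs) \<le> length xs"
    by auto
  have xz: "xs \<approx> s # zs"
    using weq_mult_left_iff zs assms(2) g by blast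
  have sz: "set zs \<subseteq> gens C"
    using zs by (simp add: reduced_def)
  \<comment> \<open>Otherwise deleting a letter of \<open>zs\<close> would give a word for
    \<open>xs\<close> that is shorter than \<open>xs\<close>.\<close>
  have "\<not> inv_parity C zs [s]"
  proof
    assume "inv_parity C zs [s]"
    then obtain as b bs where "zs = as @ b # bs" "[s] @ zs \<approx> as @ bs"
      using inv_parity_delete[of zs "[s]"] sz assms(2) by auto
    with xz have "xs \<approx> as @ bs" "length (as @ bs) < length zs"
      using weq_trans by auto
    moreover from this have "length xs \<le> length (as @ bs)"
      using assms(1) unfolding reduced_def by blast
    ultimately show False
      using len by simp
  qed
  moreover have "[s, s, s] \<approx> [s]"
    using weq_cancel[of s "[]" "[s]"] assms(2) by simp
  ultimately have "inv_parity C (s # zs) [s]"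
    using inv_parity_cong[of "[s, s, s]" "[s]" zs] sz assms(2) weq_refl by simp
  then have "inv_parity C xs [s]"
    using inv_parity_weq[OF xz] assms(2) by simp
  then show ?thesis
    using inv_parity_delete[of xs "[s]"] g assms(2) by auto
qed

text \<open>Built from the right: a letter put in front of a reduced subword either keeps it reduced
  or, by \<open>exchange\<close>, cancels one of its letters.\<close>

lemma deletion:
  assumes "set xs \<subseteq> gens C"
  shows "\<exists>ys. subseq ys xs \<and> reduced C ys \<and> xs \<approx> ys"
  using assms
proof (induction xs)
  case Nil
  then show ?case
    by (auto simp: reduced_def weq_refl)
next
  case (Cons x xs)
  then obtain ys where ys: "subseq ys xs" "reduced C ys" "xs \<approx> ys"
    by auto
  have xy: "x # xs \<approx> x # ys"
    using weq_context[OF ys(3), of "[x]" "[]"] Cons.prems by simp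
  show ?case
  proof (cases "reduced C (x # ys)")
    case True
    then show ?thesis
      using xy ys by (intro exI[of _ "x # ys"]) simp
  next
    case False
    then obtain as b bs where *: "ys = as @ b # bs" "x # ys \<approx> as @ bs"
      using exchange[OF ys(2), of x] Cons.prems by fastforce
    \<comment> \<open>A word shorter than \<open>as @ bs\<close> would, preceded by
      \<open>x\<close>, represent \<open>ys\<close> with fewer letters than
      \<open>ys\<close>.\<close>
    have "reduced C (as @ bs)"
      unfolding reduced_def
    proof (intro conjI allI impI)
      fix zs
      assume "as @ bs \<approx> zs"
      then have "x # ys \<approx> zs"
        using *(2) weq_trans by blast
      then have "ys \<approx> x # zs"
        using weq_mult_left_iff[of x ys zs] Cons.prems ys(2) by (simp add: reduced_def)
      then have "length ys \<le> length (x # zs)"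
        using ys(2) unfolding reduced_def by blast
      then show "length (as @ bs) \<le> length zs"
        using *(1) by simp
    qed (use weq_gens *(2) in blast)
    moreover have "subseq (as @ bs) ys"
      unfolding *(1) by (intro list_emb_append_mono) auto
    then have "subseq (as @ bs) (x # xs)"
      using ys(1) subseq_order.order_trans by blast
    ultimately show ?thesis
      using xy *(2) weq_trans by blast
  qed
qed

text \<open>Letters are compared as group elements, so the argument does not rely on distinct
  generators being distinct elements. The first letter \<open>z\<close> cancels, by
  \<open>exchange\<close>, one letter of a reduced subword of \<open>xs\<close>; the induction
  hypothesis then applies to the rest.\<close>

lemma reduced_weq_support:
  assumes "reduced C ys" "ys \<approx> xs" "y \<in> set ys"
  shows "\<exists>x\<in>set xs. [y] \<approx> [x]"
  using assms
proof (induction ys arbitrary: xs)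
  case (Cons z ys)
  have z: "z \<in> gens C"
    using Cons.prems(1) by (auto simp: reduced_def)
  have ys: "reduced C ys"
    using Cons.prems(1) reduced_append[of "[z]" ys "[]"] by simp
  obtain us where us: "subseq us xs" "reduced C us" "xs \<approx> us"
    using deletion Cons.prems(2) weq_gens by blast
  have zu: "z # ys \<approx> us"
    using Cons.prems(2) us(3) by (rule weq_trans)
  then have uz: "z # us \<approx> ys"
    using weq_mult_left_iff[OF z, of ys us] ys weq_sym by (simp add: reduced_def)
  have len: "length us = Suc (length ys)"
    using reduced_weq_length[OF Cons.prems(1) us(2) zu] by simp
  have "\<not> reduced C (z # us)"
    using reduced_weq_length[OF _ ys uz] len by auto
  then obtain as b bs where *: "us = as @ b # bs" "z # us \<approx> as @ bs"
    using exchange us(2) z by blast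
  have sub: "set (as @ bs) \<subseteq> set xs" "set us \<subseteq> set xs"
    using *(1) subseq_set_subset[OF us(1)] by auto
  show ?case
  proof (cases "y \<in> set ys")
    case True
    then show ?thesis
      using Cons.IH[OF ys weq_trans[OF weq_sym[OF uz] *(2)]] sub by blast
  next
    case False
    then have y: "y = z"
      using Cons.prems by simp
    \<comment> \<open>\<open>z\<close> is the quotient of \<open>as @ bs\<close> by
      \<open>us\<close>, hence a product of letters of \<open>xs\<close>; by deletion and the parity
      of the length it is one of them.\<close>
    have "[z] \<approx> (as @ bs) @ rev us"
      using weq_rev_move[of "[z]" us "as @ bs"] *(2) by simp
    then obtain vs where vs: "subseq vs ((as @ bs) @ rev us)" "reduced C vs" "[z] \<approx> vs"
      using deletion weq_gens(2) weq_trans by meson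
    have "length vs \<le> 1" "odd (length vs)"
      using vs(2) weq_sym[OF vs(3)] weq_even_length[OF vs(3)] unfolding reduced_def by fastforce+
    then obtain x where "vs = [x]"
      by (cases vs) auto
    then show ?thesis
      using vs(3) subseq_set_subset[OF vs(1)] sub y by auto
  qed
qed simp

end

section \<open>Words of type B without cancellation\<close>

lemma bond_typeB: "i + 2 \<le> j \<or> j + 2 \<le> i \<Longrightarrow> bond (typeB n) i j = 2"
  by (auto simp: typeB_def doubleton_eq_iff)

text \<open>\<open>R\<close> abstracts the set of reduced words of a fully commutative element of
  type B that is not left reducible. Only words and commutations remain; \<open>no_prefix\<close>
  encodes irreducibility on the left, \<open>no_braid\<close> full commutativity.\<close>

locale left_noncancellable_class =
  fixes n :: nat and R :: "nat list set"
  assumes letters: "xs \<in> R \<Longrightarrow> set xs \<subseteq> {1..n}"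
    and comm: "xs \<in> R \<Longrightarrow> comm_move (typeB n) xs ys \<Longrightarrow> ys \<in> R"
    and no_square: "us @ i # i # vs \<notin> R"
    and no_braid: "2 \<le> i \<Longrightarrow> us @ i # Suc i # i # vs \<notin> R"
      "2 \<le> i \<Longrightarrow> us @ Suc i # i # Suc i # vs \<notin> R"
      "us @ 1 # 2 # 1 # 2 # vs \<notin> R"
    and no_prefix: "2 \<le> i \<Longrightarrow> i # Suc i # vs \<notin> R" "2 \<le> i \<Longrightarrow> Suc i # i # vs \<notin> R"
      "1 # 2 # 1 # vs \<notin> R" "2 # 1 # 2 # vs \<notin> R"
begin

lemma comms:
  assumes "(comm_move (typeB n))\<^sup>*\<^sup>* xs ys" "xs \<in> R"
  shows "ys \<in> R"
  using assms by (induction) (auto intro: comm)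

lemma move_left:
  assumes "us @ xs @ k # vs \<in> R" "\<forall>x\<in>set xs. x + 2 \<le> k \<or> k + 2 \<le> x"
  shows "us @ k # xs @ vs \<in> R"
  using comms[OF comm_moves_context[OF comm_moves_left[of xs "typeB n" k], of us vs]] assms
  by (simp add: bond_typeB)

lemma move_right:
  assumes "us @ k # xs @ vs \<in> R" "\<forall>x\<in>set xs. x + 2 \<le> k \<or> k + 2 \<le> x"
  shows "us @ xs @ k # vs \<in> R"
proof -
  have "\<forall>x\<in>set xs. bond (typeB n) k x = 2"
    using assms(2) by (auto intro!: bond_typeB)
  then show ?thesis
    using comms[OF comm_moves_context[OF comm_moves_right[of xs "typeB n" k], of us vs]] assms(1)
    by simp
qed

lemma far_letters:
  assumes "k \<notin> set xs" "Suc k \<notin> set xs" "k - 1 \<notin> set xs"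
  shows "\<forall>x\<in>set xs. x + 2 \<le> k \<or> k + 2 \<le> x"
proof
  fix x
  assume "x \<in> set xs"
  with assms have "x \<noteq> k" "x \<noteq> Suc k" "x \<noteq> k - 1"
    by auto
  then show "x + 2 \<le> k \<or> k + 2 \<le> x"
    by linarith
qed

section \<open>Letters enclosed by two consecutive occurrences of a letter\<close>

lemma between_equal:
  assumes "us @ k # xs @ k # vs \<in> R" "k \<notin> set xs"
  shows "Suc k \<in> set xs \<or> k - 1 \<in> set xs"
proof (rule ccontr)
  assume "\<not> ?thesis"
  then have "us @ k # k # xs @ vs \<in> R"
    using move_left[of "us @ [k]" xs k vs] assms far_letters[of k xs] by simp
  then show False
    using no_square by blast
qed

text \<open>Induction from large \<open>k\<close> downwards. Suppose only \<open>k + 1\<close>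
  separates the two letters \<open>k\<close>: if it occurs twice, two of its occurrences enclose a
  \<open>k\<close> by induction; if once, commutations produce the braid factor
  \<open>k (k + 1) k\<close>.\<close>

lemma between_upper:
  assumes "us @ k # xs @ k # vs \<in> R" "k \<notin> set xs" "2 \<le> k"
  shows "k - 1 \<in> set xs"
  using assms
proof (induction "n - k" arbitrary: k us xs vs rule: less_induct)
  case less
  show ?case
  proof (rule ccontr)
    assume low: "k - 1 \<notin> set xs"
    then have "Suc k \<in> set xs"
      using between_equal less.prems by blast
    then obtain ys zs where xs: "xs = ys @ Suc k # zs" "Suc k \<notin> set ys"
      by (meson split_list_first)
    show False
    proof (cases "Suc k \<in> set zs")
      case True
      then obtain zs1 zs2 where zs: "zs = zs1 @ Suc k # zs2" "Suc k \<notin> set zs1"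
        by (meson split_list_first)
      have "Suc k \<le> n"
        using letters[OF less.prems(1)] xs by auto
      then have "Suc k - 1 \<in> set zs1"
        using less.prems zs xs
        by (intro less.hyps[of "Suc k" "us @ k # ys" zs1 "zs2 @ k # vs"]) auto
      then show False
        using less.prems xs zs by simp
    next
      case False
      have "us @ ys @ k # Suc k # zs @ k # vs \<in> R"
        using move_right[of us k ys "Suc k # zs @ k # vs"] less.prems xs low far_letters[of k ys]
        by simp
      then have "us @ ys @ k # Suc k # k # zs @ vs \<in> R"
        using move_left[of "us @ ys @ [k, Suc k]" zs k vs] less.prems xs low False
          far_letters[of k zs]
        by simp
      then show False
        using no_braid(1)[of k "us @ ys"] less.prems by simp
    qed
  qed
qed

text \<open>Induction from large \<open>k\<close> downwards. A first \<open>k + 1\<close> in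
  \<open>us\<close> is not preceded by \<open>k + 2\<close>, by induction, and is the only
  \<open>k + 1\<close> in \<open>us\<close>, by \<open>between_upper\<close>. So it moves to the
  front with \<open>k\<close> right behind it, against \<open>no_prefix\<close>.\<close>

lemma minimal_then_successor:
  assumes "us @ k # vs \<in> R" "\<forall>x\<in>set us. k < x" "2 \<le> k"
  shows "Suc k \<notin> set us"
  using assms
proof (induction "n - k" arbitrary: k us vs rule: less_induct)
  case less
  show ?case
  proof
    assume "Suc k \<in> set us"
    then obtain ys zs where us: "us = ys @ Suc k # zs" "Suc k \<notin> set ys"
      by (meson split_list_first)
    have "Suc k \<le> n"
      using letters[OF less.prems(1)] us by auto
    moreover have "\<forall>x\<in>set ys. Suc k < x"
      using less.prems(2) us by (metis Suc_lessI Un_iff set_append)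
    ultimately have ys: "Suc (Suc k) \<notin> set ys"
      using less.prems us
      by (intro less.hyps[of "Suc k" ys "zs @ k # vs"]) auto
    have "Suc k \<notin> set zs"
    proof
      assume "Suc k \<in> set zs"
      then obtain zs1 zs2 where zs: "zs = zs1 @ Suc k # zs2" "Suc k \<notin> set zs1"
        by (meson split_list_first)
      have "Suc k - 1 \<in> set zs1"
        using less.prems zs us
        by (intro between_upper[of ys "Suc k" zs1 "zs2 @ k # vs"]) auto
      then show False
        using less.prems us zs by auto
    qed
    moreover have "\<forall>x\<in>set zs. k < x"
      using less.prems(2) us by simp
    ultimately have "\<forall>x\<in>set zs. x + 2 \<le> k \<or> k + 2 \<le> x"
      by (metis Suc_lessI Suc_leI add_2_eq_Suc')
    then have "ys @ Suc k # k # zs @ vs \<in> R"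
      using move_left[of "ys @ [Suc k]" zs k vs] less.prems us by simp
    then have "Suc k # ys @ k # zs @ vs \<in> R"
      using move_left[of "[]" ys "Suc k" "k # zs @ vs"] us ys less.prems(2)
        far_letters[of "Suc k" ys]
      by auto
    moreover have ys_far: "\<forall>x\<in>set ys. x + 2 \<le> k \<or> k + 2 \<le> x"
      using us less.prems(2) by (metis Suc_lessI Suc_leI add_2_eq_Suc' Un_iff set_append)
    ultimately have "Suc k # k # ys @ zs @ vs \<in> R"
      using move_left[of "[Suc k]" ys k "zs @ vs"] ys_far by simp
    then show False
      using no_prefix(2) less.prems by blast
  qed
qed

text \<open>Without a 3, exactly one 1 lies between the two letters 2. Consider the last 1 or 2
  before them: a 2 would have to be followed by another 1, and a 1 yields the factor 1 2 1 2. If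
  there is none, there is no 3 either by \<open>minimal_then_successor\<close>, and 2 1 2 becomes a
  prefix.\<close>

lemma no_valley:
  assumes "us @ 2 # xs @ 2 # vs \<in> R" "2 \<notin> set xs"
  shows "3 \<in> set xs"
proof (rule ccontr)
  assume three: "3 \<notin> set xs"
  have "1 \<in> set xs"
    using between_upper[OF assms] by simp
  then obtain ys zs where xs: "xs = ys @ 1 # zs" "1 \<notin> set ys"
    by (meson split_list_first)
  have one: "1 \<notin> set zs"
  proof
    assume "1 \<in> set zs"
    then obtain zs1 zs2 where zs: "zs = zs1 @ 1 # zs2" "1 \<notin> set zs1"
      by (meson split_list_first)
    have "Suc 1 \<in> set zs1 \<or> 1 - 1 \<in> set zs1"
      using assms zs xs by (intro between_equal[of "us @ 2 # ys" 1 zs1 "zs2 @ 2 # vs"]) auto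
    moreover have "0 \<notin> set zs1"
      using letters[OF assms(1)] xs zs by auto
    ultimately show False
      using assms xs zs by (simp add: numeral_2_eq_2)
  qed
  have pos: "x \<noteq> 0" if "x \<in> set us \<union> set xs" for x
    using letters[OF assms(1)] that by auto
  have far: "\<forall>x\<in>set ys. 4 \<le> x" "\<forall>x\<in>set zs. 4 \<le> x"
  proof -
    have "4 \<le> x" if "x \<in> set ys \<union> set zs" for x
    proof -
      have "x \<noteq> 0" "x \<noteq> 1" "x \<noteq> 2" "x \<noteq> 3"
        using that xs one assms three pos[of x] by auto
      then show ?thesis
        by linarith
    qed
    then show "\<forall>x\<in>set ys. 4 \<le> x" "\<forall>x\<in>set zs. 4 \<le> x"
      by auto
  qed
  \<comment> \<open>\<open>ws\<close> stands for everything up to and including the left 2 after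
    rearrangement; the braid case and the prefix case instantiate it differently.\<close>
  have core: "ws @ 1 # ys @ zs @ 2 # vs \<in> R \<and> ws @ 1 # 2 # ys @ zs @ vs \<in> R"
    if "ws @ ys @ 1 # zs @ 2 # vs \<in> R" for ws
  proof -
    have 1: "ws @ 1 # ys @ zs @ 2 # vs \<in> R"
      using move_left[of ws ys 1 "zs @ 2 # vs"] that far by force
    moreover have "ws @ 1 # 2 # (ys @ zs) @ vs \<in> R"
      using move_left[of "ws @ [1]" "ys @ zs" 2 vs] 1 far by force
    ultimately show ?thesis
      by simp
  qed
  have "\<not> (\<exists>x\<in>set us. x = 1 \<or> x = 2)"
  proof
    assume "\<exists>x\<in>set us. x = 1 \<or> x = 2"
    then obtain us1 x us2 where us: "us = us1 @ x # us2" "x = 1 \<or> x = 2"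
        "\<forall>y\<in>set us2. \<not> (y = 1 \<or> y = 2)"
      using split_list_last_prop[of us "\<lambda>x. x = 1 \<or> x = 2"] by metis
    have us2: "\<forall>y\<in>set us2. 3 \<le> y"
    proof
      fix y
      assume y: "y \<in> set us2"
      then have "y \<noteq> 0" "y \<noteq> 1" "y \<noteq> 2"
        using us(3) pos[of y] us(1) by auto
      then show "3 \<le> y"
        by linarith
    qed
    from us(2) show False
    proof
      assume "x = 2"
      then have "2 - 1 \<in> set us2"
        using assms us by (intro between_upper[of us1 2 us2 "xs @ 2 # vs"]) auto
      moreover have "2 - 1 \<notin> set us2"
        using us(3) by fastforce
      ultimately show False
        by blast
    next
      assume "x = 1"
      then have "us1 @ us2 @ 1 # 2 # ys @ 1 # zs @ 2 # vs \<in> R"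
        using move_right[of us1 1 us2 "2 # ys @ 1 # zs @ 2 # vs"] assms xs us us2 by force
      then have "(us1 @ us2 @ [1, 2]) @ 1 # 2 # ys @ zs @ vs \<in> R"
        using core[of "us1 @ us2 @ [1, 2]"] by simp
      then show False
        using no_braid(3)[of "us1 @ us2"] by simp
    qed
  qed
  then have us12: "1 \<notin> set us" "2 \<notin> set us"
    by auto
  have "\<forall>x\<in>set us. 2 < x"
  proof
    fix x
    assume "x \<in> set us"
    then have "x \<noteq> 0" "x \<noteq> 1" "x \<noteq> 2"
      using us12 pos[of x] by auto
    then show "2 < x"
      by linarith
  qed
  moreover from this have "Suc 2 \<notin> set us"
    using assms by (intro minimal_then_successor[of us 2 "xs @ 2 # vs"]) auto
  ultimately have us: "\<forall>x\<in>set us. 4 \<le> x"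
    by (metis Suc_leI eval_nat_numeral(2,3) le_neq_implies_less semiring_norm(26,27,28))
  have "[2] @ us @ ys @ 1 # zs @ 2 # vs \<in> R"
    using move_left[of "[]" us 2 "xs @ 2 # vs"] assms xs us by force
  then have "2 # us @ 1 # 2 # ys @ zs @ vs \<in> R"
    using core[of "2 # us"] by simp
  then have "2 # 1 # us @ 2 # ys @ zs @ vs \<in> R"
    using move_left[of "[2]" us 1 "2 # ys @ zs @ vs"] us by force
  then have "2 # 1 # 2 # us @ ys @ zs @ vs \<in> R"
    using move_left[of "[2, 1]" us 2 "ys @ zs @ vs"] us by force
  then show False
    using no_prefix(4) by blast
qed

text \<open>Upward counterpart of \<open>between_upper\<close>, started by \<open>no_valley\<close>:
  two letters \<open>k\<close> between letters \<open>k + 1\<close> enclose a \<open>k + 1\<close>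
  by induction, and a single one gives the braid factor \<open>(k + 1) k (k + 1)\<close>.\<close>

lemma between_lower:
  assumes "us @ k # xs @ k # vs \<in> R" "k \<notin> set xs" "2 \<le> k"
  shows "Suc k \<in> set xs"
  using assms(3,1,2)
proof (induction k arbitrary: us xs vs rule: nat_induct_at_least)
  case base
  then show ?case
    using no_valley by simp
next
  case (Suc k)
  show ?case
  proof (rule ccontr)
    assume up: "Suc (Suc k) \<notin> set xs"
    have "k \<in> set xs"
      using between_upper[OF Suc.prems] Suc.hyps by simp
    then obtain ys zs where xs: "xs = ys @ k # zs" "k \<notin> set ys"
      by (meson split_list_first)
    show False
    proof (cases "k \<in> set zs")
      case True
      then obtain zs1 zs2 where zs: "zs = zs1 @ k # zs2" "k \<notin> set zs1"
        by (meson split_list_first)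
      have "Suc k \<in> set zs1"
        using Suc.prems zs xs
        by (intro Suc.IH[of "us @ Suc k # ys" zs1 "zs2 @ Suc k # vs"]) auto
      then show False
        using Suc.prems xs zs by simp
    next
      case False
      have "us @ ys @ Suc k # k # zs @ Suc k # vs \<in> R"
        using move_right[of us "Suc k" ys "k # zs @ Suc k # vs"] Suc.prems xs up
          far_letters[of "Suc k" ys]
        by simp
      then have "us @ ys @ Suc k # k # Suc k # zs @ vs \<in> R"
        using move_left[of "us @ ys @ [Suc k, k]" zs "Suc k" vs] Suc.prems xs up False
          far_letters[of "Suc k" zs]
        by simp
      then show False
        using no_braid(2)[of k "us @ ys"] Suc.hyps by simp
    qed
  qed
qed

section \<open>First occurrences and the forced suffix\<close>

text \<open>Descent from \<open>k + 1\<close> to \<open>k\<close>: a single \<open>k\<close>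
  precedes the first \<open>k + 1\<close>, since two would enclose a \<open>k + 1\<close>. Were
  there no \<open>k - 1\<close> in front of this \<open>k\<close>, the word could be made to start
  with \<open>k (k + 1)\<close>.\<close>

lemma descending_chain:
  assumes "xs \<in> R" "xs = us @ b # vs" "b \<notin> set us" "b - 1 \<in> set us" "Suc b \<notin> set us"
    and "2 \<le> k" "k \<le> b"
  shows "\<exists>us vs. xs = us @ k # vs \<and> k \<notin> set us \<and> k - 1 \<in> set us \<and> Suc k \<notin> set us"
  using assms(7,6)
proof (induction k rule: inc_induct)
  case base
  then show ?case
    using assms by blast
next
  case (step k)
  then obtain us vs where xs: "xs = us @ Suc k # vs" "Suc k \<notin> set us" "k \<in> set us"
      "Suc (Suc k) \<notin> set us"
    by auto
  then obtain ys zs where us: "us = ys @ k # zs" "k \<notin> set ys"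
    by (meson split_list_first)
  have zs: "k \<notin> set zs"
  proof
    assume "k \<in> set zs"
    then obtain zs1 zs2 where zs: "zs = zs1 @ k # zs2" "k \<notin> set zs1"
      by (meson split_list_first)
    have "Suc k \<in> set zs1"
      using assms(1) xs us zs step.prems
      by (intro between_lower[of ys k zs1 "zs2 @ Suc k # vs"]) auto
    then show False
      using xs us zs by simp
  qed
  have "k - 1 \<in> set ys"
  proof (rule ccontr)
    assume *: "k - 1 \<notin> set ys"
    have "k # ys @ zs @ Suc k # vs \<in> R"
      using move_left[of "[]" ys k "zs @ Suc k # vs"] assms(1) xs us * far_letters[of k ys]
      by simp
    then have "k # Suc k # (ys @ zs) @ vs \<in> R"
      using move_left[of "[k]" "ys @ zs" "Suc k" vs] xs us zs far_letters[of "Suc k" "ys @ zs"]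
      by simp
    then show False
      using no_prefix(1) step.prems by blast
  qed
  then show ?case
    using xs us by (intro exI[of _ ys] exI[of _ "zs @ Suc k # vs"]) auto
qed

text \<open>The left conditions alone force a suffix that the right conditions forbid. The letters
  \<open>1, ..., b\<close> occur once each and in ascending order, so apart from \<open>b\<close>
  nothing to the right of \<open>b - 1\<close> obstructs it, and both move to the end.\<close>

lemma no_ascending_suffix:
  assumes "xs \<in> R" "xs = us @ b # vs" "b \<notin> set us" "b - 1 \<in> set us" "Suc b \<notin> set xs" "3 \<le> b"
  shows "\<exists>ys. ys @ [b - 1, b] \<in> R"
proof -
  have chain: "\<exists>us vs. xs = us @ k # vs \<and> k \<notin> set us \<and> k - 1 \<in> set us \<and> Suc k \<notin> set us"
    if "2 \<le> k" "k \<le> b" for k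
    using descending_chain[OF assms(1-4) _ that] assms by auto
  \<comment> \<open>Upward induction: two letters \<open>k + 1\<close> enclose a \<open>k\<close> by
    \<open>between_upper\<close>, while another \<open>k\<close> already precedes the first of
    them.\<close>
  have once: "count_list xs k = 1" if "1 \<le> k" "k \<le> b" for k
    using that
  proof (induction k rule: nat_induct_at_least)
    case base
    obtain us vs where xs: "xs = us @ 2 # vs" "2 \<notin> set us" "1 \<in> set us" "3 \<notin> set us"
      using chain[of 2] assms(6) by auto
    then obtain ys zs where us: "us = ys @ 1 # zs" "1 \<notin> set ys"
      by (meson split_list_first)
    have pos: "0 \<notin> set xs"
      using letters[OF assms(1)] by auto
    have zs: "1 \<notin> set zs"
    proof
      assume "1 \<in> set zs"
      then obtain zs1 zs2 where zs: "zs = zs1 @ 1 # zs2" "1 \<notin> set zs1"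
        by (meson split_list_first)
      have "Suc 1 \<in> set zs1 \<or> 1 - 1 \<in> set zs1"
        using assms(1) xs us zs by (intro between_equal[of ys 1 zs1 "zs2 @ 2 # vs"]) auto
      then show False
        using xs us zs pos by (auto simp: numeral_2_eq_2)
    qed
    \<comment> \<open>Up to a second 1 there is only one 2, as two would enclose a 1; so the word
      could be made to start with 1 2 1.\<close>
    have vs: "1 \<notin> set vs"
    proof
      assume "1 \<in> set vs"
      then obtain vs1 vs2 where vs: "vs = vs1 @ 1 # vs2" "1 \<notin> set vs1"
        by (meson split_list_first)
      have two: "2 \<notin> set vs1"
      proof
        assume "2 \<in> set vs1"
        then obtain ws1 ws2 where ws: "vs1 = ws1 @ 2 # ws2" "2 \<notin> set ws1"
          by (meson split_list_first)
        then have "2 - 1 \<in> set ws1"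
          using assms(1) xs vs by (intro between_upper[of us 2 ws1 "ws2 @ 1 # vs2"]) auto
        then show False
          using vs ws by simp
      qed
      have "1 # ys @ zs @ 2 # vs1 @ 1 # vs2 \<in> R"
        using move_left[of "[]" ys 1 "zs @ 2 # vs"] assms(1) xs us vs pos far_letters[of 1 ys]
        by (simp add: numeral_2_eq_2)
      then have "1 # 2 # (ys @ zs) @ vs1 @ 1 # vs2 \<in> R"
        using move_left[of "[1]" "ys @ zs" 2 "vs1 @ 1 # vs2"] xs us zs
          far_letters[of 2 "ys @ zs"]
        by simp
      then have "1 # 2 # 1 # (ys @ zs @ vs1) @ vs2 \<in> R"
        using move_left[of "[1, 2]" "ys @ zs @ vs1" 1 vs2] xs us zs two pos vs
          far_letters[of 1 "ys @ zs @ vs1"]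
        by (simp add: numeral_2_eq_2)
      then show False
        using no_prefix(3) by blast
    qed
    show ?case
      using xs us zs vs by (auto simp: count_list_0_iff)
  next
    case (Suc k)
    then obtain us vs where xs: "xs = us @ Suc k # vs" "Suc k \<notin> set us" "k \<in> set us"
      using chain[of "Suc k"] by auto
    have "Suc k \<notin> set vs"
    proof
      assume "Suc k \<in> set vs"
      then obtain ws1 ws2 where ws: "vs = ws1 @ Suc k # ws2" "Suc k \<notin> set ws1"
        by (meson split_list_first)
      then have "Suc k - 1 \<in> set ws1"
        using assms(1) xs Suc.hyps by (intro between_upper[of us "Suc k" ws1 ws2]) auto
      then have "count_list us k \<noteq> 0" "count_list ws1 k \<noteq> 0"
        using xs by (simp_all add: count_list_0_iff)
      moreover have "count_list xs k = 1"
        using Suc by simp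
      ultimately show False
        using xs ws by simp
    qed
    then show ?case
      using xs by (simp add: count_list_0_iff)
  qed
  have single: "k \<notin> set ys" "k \<notin> set zs" if "xs = ys @ k # zs" "1 \<le> k" "k \<le> b" for ys zs k
    using once[OF that(2,3)] that(1) by (simp_all add: count_list_0_iff)
  \<comment> \<open>\<open>3 \<le> b\<close> makes \<open>b - 1\<close> admissible in
    \<open>chain\<close>: \<open>b - 2\<close> occurs before \<open>b - 1\<close> and hence,
    occurring once, not after it.\<close>
  obtain ys ws where ys: "xs = ys @ (b - 1) # ws" "b - 1 - 1 \<in> set ys" "b \<notin> set ys"
    using chain[of "b - 1"] assms(6) by fastforce
  have "b \<in> set ws"
    using assms(2,6) ys by (metis Un_iff diff_less in_set_conv_decomp less_irrefl less_le_trans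
      set_ConsD set_append zero_less_numeral zero_less_one)
  then obtain zs vs where ws: "ws = zs @ b # vs"
    by (meson split_list)
  obtain us1 us2 where "ys = us1 @ (b - 1 - 1) # us2"
    using ys(2) by (meson split_list)
  then have b2: "b - 1 - 1 \<notin> set zs" "b - 1 - 1 \<notin> set vs"
    using single(2)[of us1 "b - 1 - 1" "us2 @ (b - 1) # ws"] ys ws assms(6) by auto
  have b1: "b - 1 \<notin> set zs" "b - 1 \<notin> set vs"
    using single(2)[of ys "b - 1" ws] ys ws assms(6) by auto
  have b0: "b \<notin> set zs" "b \<notin> set vs"
    using single[of "ys @ (b - 1) # zs" b vs] ys ws assms(6) by auto
  have "ys @ (b - 1) # zs @ vs @ [b] \<in> R"
    using move_right[of "ys @ (b - 1) # zs" b vs "[]"] assms(1,5) ys ws b0 b1 far_letters[of b vs]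
    by auto
  moreover have "\<forall>x\<in>set (zs @ vs). x + 2 \<le> b - 1 \<or> b - 1 + 2 \<le> x"
    using b0 b1 b2 assms(6) by (intro far_letters) auto
  ultimately have "(ys @ zs @ vs) @ [b - 1, b] \<in> R"
    using move_right[of ys "b - 1" "zs @ vs" "[b]"] by simp
  then show ?thesis
    by blast
qed

end

text \<open>The right-hand conditions are the left-hand ones for the reversed words, so every lemma
  is available at both ends.\<close>

locale noncancellable_class = left_noncancellable_class n R + rev: left_noncancellable_class n "rev ` R"
  for n R
begin

lemma no_adjacent:
  assumes "xs \<in> R" "k \<in> set xs" "Suc k \<in> set xs" "2 \<le> k"
  shows False
proof -
  \<comment> \<open>The upper letter of the highest adjacent pair, so that \<open>b + 1\<close> does
    not occur.\<close>
  define b where "b = (GREATEST b. b \<in> set xs \<and> b - 1 \<in> set xs)"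
  have bound: "\<And>y. y \<in> set xs \<and> y - 1 \<in> set xs \<Longrightarrow> y \<le> n"
    using letters[OF assms(1)] by auto
  have "b \<in> set xs \<and> b - 1 \<in> set xs"
    unfolding b_def by (rule GreatestI_nat[of _ "Suc k" n]) (use assms bound in auto)
  then have b: "b \<in> set xs" "b - 1 \<in> set xs"
    by auto
  have "Suc k \<le> b"
    unfolding b_def by (rule Greatest_le_nat[of _ "Suc k" n]) (use assms bound in auto)
  have top: "Suc b \<notin> set xs"
  proof
    assume "Suc b \<in> set xs"
    then have "Suc b \<le> b"
      unfolding b_def by (intro Greatest_le_nat[of _ _ n]) (use b[unfolded b_def] bound in auto)
    then show False
      by simp
  qed
  from b(1) obtain us vs where xs: "xs = us @ b # vs" "b \<notin> set us"
    by (meson split_list_first)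
  \<comment> \<open>Two letters \<open>b\<close> would enclose a \<open>b + 1\<close> by
    \<open>between_lower\<close>.\<close>
  have vs: "b \<notin> set vs"
  proof
    assume "b \<in> set vs"
    then obtain vs1 vs2 where "vs = vs1 @ b # vs2" "b \<notin> set vs1"
      by (meson split_list_first)
    then show False
      using between_lower[of us b vs1 vs2] assms xs top \<open>Suc k \<le> b\<close> by auto
  qed
  have c: "Suc (b - 1) = b" "2 \<le> b - 1" "3 \<le> b"
    using \<open>Suc k \<le> b\<close> assms(4) by auto
  then have "b - 1 \<noteq> b"
    by auto
  then consider "b - 1 \<in> set us" | "b - 1 \<in> set vs"
    using b(2) xs by auto
  then show False
  proof cases
    case 1
    then obtain ys where "ys @ [b - 1, b] \<in> R"
      using no_ascending_suffix[OF assms(1) xs] top c by blast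
    then have "rev (ys @ [b - 1, b]) \<in> rev ` R"
      by blast
    then show False
      using rev.no_prefix(2)[of "b - 1" "rev ys"] c by simp
  next
    case 2
    \<comment> \<open>In the reversed word \<open>b - 1\<close> precedes \<open>b\<close>; the
      suffix found there is a forbidden prefix of a word in \<open>R\<close>.\<close>
    have "rev xs = rev vs @ b # rev us"
      using xs by simp
    moreover have "rev xs \<in> rev ` R"
      using assms(1) by simp
    ultimately have "\<exists>ys. ys @ [b - 1, b] \<in> rev ` R"
      using 2 vs top c by (intro rev.no_ascending_suffix[of "rev xs" "rev vs" b "rev us"])
        (use xs in simp_all)
    then obtain ys where "ys @ [b - 1, b] \<in> rev ` R"
      by blast
    then have "rev (ys @ [b - 1, b]) \<in> R"
      by (metis imageE rev_rev_ident)
    then show False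
      using no_prefix(2)[of "b - 1" "rev ys"] c by simp
  qed
qed

lemma far_or_low:
  assumes "xs \<in> R" "x \<in> set xs" "y \<in> set xs" "x \<noteq> y"
  shows "x + 2 \<le> y \<or> y + 2 \<le> x \<or> {x, y} = {1, 2}"
proof -
  have "x \<ge> 1" "y \<ge> 1"
    using letters[OF assms(1)] assms by auto
  moreover have "y \<noteq> Suc x" if "x \<noteq> 1"
    using no_adjacent[OF assms(1), of x] assms that \<open>x \<ge> 1\<close> by auto
  moreover have "x \<noteq> Suc y" if "y \<noteq> 1"
    using no_adjacent[OF assms(1), of y] assms that \<open>y \<ge> 1\<close> by auto
  moreover have "{1::nat, Suc 1} = {1, 2}" "{Suc 1, 1::nat} = {1, 2}"
    by auto
  moreover have "x = 1 \<and> y = Suc 1 \<or> y = 1 \<and> x = Suc 1 \<or> x + 2 \<le> y \<or> y + 2 \<le> x"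
    using calculation(1-4) assms(4) by linarith
  ultimately show ?thesis
    by metis
qed

lemma isolated_once:
  assumes "us @ k # xs @ k # vs \<in> R"
    and "\<forall>x\<in>set xs. x = k \<or> x + 2 \<le> k \<or> k + 2 \<le> x"
  shows False
proof -
  \<comment> \<open>The given second \<open>k\<close> need not be the next one; \<open>ys\<close> is
    the stretch up to the next occurrence.\<close>
  have "k \<in> set (xs @ [k])"
    by simp
  then obtain ys zs where *: "xs @ [k] = ys @ k # zs" "k \<notin> set ys"
    by (meson split_list_first)
  then have "set ys \<subseteq> set xs"
    by (metis (no_types, lifting) append_butlast_last_id butlast_append butlast_snoc
        list.distinct(1) set_append sup_ge1)
  moreover have "us @ k # ys @ k # zs @ vs \<in> R"
    using assms(1) *(1) by (metis append.assoc append_Cons append_Nil)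
  ultimately show False
    using between_equal[of us k ys "zs @ vs"] *(2) assms(2) by force
qed

lemma isolated_distinct:
  assumes "us @ xs @ vs \<in> R"
    and "\<forall>x\<in>set xs. \<forall>y\<in>set xs. x \<noteq> y \<longrightarrow> x + 2 \<le> y \<or> y + 2 \<le> x"
  shows "distinct xs"
proof (rule ccontr)
  assume "\<not> distinct xs"
  then obtain as bs cs k where "xs = as @ [k] @ bs @ [k] @ cs"
    using not_distinct_decomp by blast
  then show False
    using isolated_once[of "us @ as" k bs "cs @ vs"] assms by auto
qed

text \<open>By \<open>no_adjacent\<close> only 1 and 2 can be neighbouring letters. If both occur, 3
  does not, so the letters 1 and 2 can be collected in front; the absence of squares and of the
  prefixes 1 2 1 and 2 1 2 leaves just two of them.\<close>

theorem normal_form: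
  assumes "xs \<in> R"
  obtains (commuting) "distinct xs" "\<forall>x\<in>set xs. \<forall>y\<in>set xs. x \<noteq> y \<longrightarrow> x + 2 \<le> y \<or> y + 2 \<le> x"
  | (bond4) x y us where "x # y # us \<in> R" "(x, y) = (1, 2) \<or> (x, y) = (2, 1)" "distinct us"
      "\<forall>x\<in>set us. 4 \<le> x \<and> (\<forall>y\<in>set us. x \<noteq> y \<longrightarrow> x + 2 \<le> y \<or> y + 2 \<le> x)"
proof (cases "1 \<in> set xs \<and> 2 \<in> set xs")
  case False
  have "\<forall>x\<in>set xs. \<forall>y\<in>set xs. x \<noteq> y \<longrightarrow> x + 2 \<le> y \<or> y + 2 \<le> x"
    using far_or_low[OF assms] False by (metis insertCI insertE singletonD)
  then show ?thesis
    using isolated_distinct[of "[]" xs "[]"] assms commuting by simp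
next
  case True
  have "4 \<le> x" if "x \<in> set xs" "\<not> x \<le> 2" for x
    using far_or_low[OF assms that(1), of 2] True that by force
  then have big: "\<forall>x\<in>set xs. \<not> x \<le> 2 \<longrightarrow> 4 \<le> x"
    by blast
  define ps us where "ps = filter (\<lambda>x. x \<le> 2) xs" and "us = filter (\<lambda>x. \<not> x \<le> 2) xs"
  have us4: "\<forall>x\<in>set us. 4 \<le> x"
    using big by (auto simp: us_def)
  have inR: "ps @ us \<in> R"
    unfolding ps_def us_def
    by (rule comms[OF comm_moves_partition assms]) (use big in \<open>auto intro!: bond_typeB\<close>)
  have sub: "set us \<subseteq> set xs"
    by (auto simp: us_def)
  have far: "\<forall>x\<in>set us. \<forall>y\<in>set us. x \<noteq> y \<longrightarrow> x + 2 \<le> y \<or> y + 2 \<le> x"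
  proof (intro ballI impI)
    fix x y assume xy: "x \<in> set us" "y \<in> set us" "x \<noteq> y"
    then have "{x, y} \<noteq> {1, 2}"
      using us4 by fastforce
    then show "x + 2 \<le> y \<or> y + 2 \<le> x"
      using far_or_low[OF assms, of x y] xy sub by blast
  qed
  have "distinct us"
    using isolated_distinct[of ps us "[]"] inR far by simp
  have low: "x = 1 \<or> x = 2" if "x \<in> set ps" for x
    using that letters[OF assms] by (force simp: ps_def)
  obtain x ps1 where ps1: "ps = x # ps1"
    using True by (cases ps) (auto simp: ps_def filter_empty_conv)
  obtain y ps2 where ps2: "ps1 = y # ps2"
  proof (cases ps1)
    case Nil
    have "1 \<in> set ps" "2 \<in> set ps"
      using True by (auto simp: ps_def)
    then show ?thesis
      using ps1 Nil by simp
  qed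
  have "x \<noteq> y"
    using no_square[of "[]" x "ps2 @ us"] inR ps1 ps2 by auto
  then have xy: "(x, y) = (1, 2) \<or> (x, y) = (2, 1)"
    using low[of x] low[of y] ps1 ps2 by auto
  have "ps2 = []"
  proof (cases ps2)
    case (Cons z ps3)
    have "y \<noteq> z"
      using no_square[of "[x]" y "ps3 @ us"] inR ps1 ps2 Cons by auto
    then have "z = x"
      using low[of z] xy ps1 ps2 Cons by auto
    then show ?thesis
      using no_prefix(3,4)[of "ps3 @ us"] inR ps1 ps2 Cons xy by auto
  qed
  then show ?thesis
    using bond4[of x y us] inR ps1 ps2 xy \<open>distinct us\<close> us4 far by auto
qed

end

section \<open>Full commutativity and reducibility in terms of words\<close>

context coxeter_system
begin

lemma comms_sym:
  assumes "xs \<leadsto> ys" "set xs \<subseteq> gens C"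
  shows "ys \<leadsto> xs"
  using assms(1)
proof (induction)
  case (step ys zs)
  have "set ys \<subseteq> gens C"
    using comms_weq[OF step.hyps(1) assms(2)] weq_gens by blast
  with step.hyps(2) have "comm_move C zs ys"
    by cases (use bond_sym in \<open>auto intro!: comm_move.intros[of C _ _ _ _, simplified]\<close>)
  with step.IH show ?case
    by (meson converse_rtranclp_into_rtranclp)
qed simp

lemma comms_reduced: "xs \<leadsto> ys \<Longrightarrow> reduced C xs \<Longrightarrow> reduced C ys"
  using reduced_same_length[of xs ys] comms_weq[of xs ys]
    mset_eq_length[OF comm_moves_mset, of C xs ys]
  by (simp add: reduced_def)

lemma word_elt_eq_weq:
  "set xs \<subseteq> gens C \<Longrightarrow> set ys \<subseteq> gens C \<Longrightarrow> word_elt C xs = word_elt C ys \<longleftrightarrow> xs \<approx> ys"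
  by (intro word_elt_eq_iff) auto

lemma mult_words:
  assumes "set xs \<subseteq> gens C" "s \<in> gens C"
  shows "gen C s \<otimes>\<^bsub>cox_group C\<^esub> word_elt C xs = word_elt C (s # xs)"
    and "word_elt C xs \<otimes>\<^bsub>cox_group C\<^esub> gen C s = word_elt C (xs @ [s])"
  using mult_word_elt[of "[s]" C xs] mult_word_elt[of xs C "[s]"] assms
  by (auto simp: gen_def in_lists_conv_set)

lemma gen_commute_iff:
  "s \<in> gens C \<Longrightarrow> t \<in> gens C \<Longrightarrow>
    gen C s \<otimes>\<^bsub>cox_group C\<^esub> gen C t = gen C t \<otimes>\<^bsub>cox_group C\<^esub> gen C s \<longleftrightarrow> [s, t] \<approx> [t, s]"
  using mult_words(1)[of "[t]" s] mult_words(1)[of "[s]" t] word_elt_eq_weq[of "[s, t]" "[t, s]"]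
  by (simp add: gen_def)

lemma len_word_elt:
  assumes "reduced C zs" "xs \<approx> zs"
  shows "len C (word_elt C xs) = length zs"
  unfolding len_def
proof (rule Least_equality)
  show "\<exists>ys\<in>lists (gens C). word_elt C ys = word_elt C xs \<and> length ys = length zs"
    using assms word_elt_eq_weq[of zs xs] weq_gens[OF assms(2)] weq_sym
    by (intro bexI[of _ zs]) auto
next
  fix k
  assume "\<exists>ys\<in>lists (gens C). word_elt C ys = word_elt C xs \<and> length ys = k"
  then obtain ys where ys: "set ys \<subseteq> gens C" "word_elt C ys = word_elt C xs" "length ys = k"
    by auto
  then have "ys \<approx> xs"
    using word_elt_eq_weq weq_gens(1)[OF assms(2)] by blast
  then have "zs \<approx> ys"
    using assms(2) weq_trans weq_sym by blast
  then show "length zs \<le> k"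
    using assms(1) ys(3) by (auto simp: reduced_def)
qed

lemma reduced_expr_iff:
  assumes "set xs \<subseteq> gens C"
  shows "reduced_expr C (word_elt C xs) ys \<longleftrightarrow> reduced C ys \<and> xs \<approx> ys"
proof -
  obtain zs where zs: "reduced C zs" "xs \<approx> zs"
    using ex_reduced[OF assms] by blast
  show ?thesis
  proof
    assume *: "reduced_expr C (word_elt C xs) ys"
    then have ys: "xs \<approx> ys" "length ys = length zs"
      using word_elt_eq_weq[of xs ys] assms len_word_elt[OF zs] by (auto simp: reduced_expr_def)
    then have "zs \<approx> ys"
      using zs(2) weq_trans weq_sym by blast
    then show "reduced C ys \<and> xs \<approx> ys"
      using reduced_same_length[OF zs(1)] ys by simp
  next
    assume *: "reduced C ys \<and> xs \<approx> ys"
    then show "reduced_expr C (word_elt C xs) ys"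
      using len_word_elt[of ys xs] word_elt_eq_weq[of ys xs] assms weq_sym
      by (auto simp: reduced_expr_def reduced_def)
  qed
qed

abbreviation fc :: "'a list \<Rightarrow> bool" where
  "fc xs \<equiv> fully_commutative C (word_elt C xs)"

lemma fc_iff:
  assumes "set xs \<subseteq> gens C"
  shows "fc xs \<longleftrightarrow>
    (\<forall>ys zs. reduced C ys \<longrightarrow> reduced C zs \<longrightarrow> xs \<approx> ys \<longrightarrow> xs \<approx> zs \<longrightarrow> ys \<leadsto> zs)"
  using assms by (auto simp: fully_commutative_def reduced_expr_iff carrier_cox_group)

lemma fc_comms:
  assumes "fc xs" "reduced C ys" "reduced C zs" "xs \<approx> ys" "xs \<approx> zs"
  shows "ys \<leadsto> zs"
  using assms fc_iff[of xs] weq_gens(1)[OF assms(4)] by blast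

lemma fc_cong: "xs \<approx> ys \<Longrightarrow> fc xs \<longleftrightarrow> fc ys"
  using word_elt_eq_weq[of xs ys] weq_gens[of xs ys] by simp

text \<open>The standard way to refute full commutativity below: exhibit two reduced words with
  different \<open>s, t\<close> subwords.\<close>

lemma fc_filter:
  assumes "fc xs" "reduced C ys" "reduced C zs" "xs \<approx> ys" "xs \<approx> zs"
    and "s \<in> gens C" "t \<in> gens C" "3 \<le> bond C s t"
  shows "filter (\<lambda>x. x = s \<or> x = t) ys = filter (\<lambda>x. x = s \<or> x = t) zs"
  using comm_moves_filter[OF fc_comms[OF assms(1-5)], of s t] assms(6-8) bond_sym[of s t] by simp

text \<open>Replacing \<open>x\<close> by \<open>z\<close> gives another reduced word of the same
  element, and commutations preserve the multiset of letters.\<close>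

lemma fc_letter_unique:
  assumes "fc xs" "reduced C (us @ x # vs)" "xs \<approx> us @ x # vs" "[z] \<approx> [x]"
  shows "z = x"
proof -
  have "us @ x # vs \<approx> us @ z # vs"
    using weq_context[OF weq_sym[OF assms(4)], of us vs] assms(2) by (simp add: reduced_def)
  then have "us @ x # vs \<leadsto> us @ z # vs"
    using fc_comms[OF assms(1,2) reduced_same_length[OF assms(2)] assms(3)] weq_trans[OF assms(3)]
    by simp
  then show ?thesis
    using comm_moves_mset by fastforce
qed

text \<open>Swapping \<open>s\<close> and \<open>t\<close> gives another reduced word, whose
  \<open>s, t\<close> subword would differ. This takes the place of computing the order of
  \<open>s t\<close> in the group.\<close>

lemma fc_commuting_factor:
  assumes "fc xs" "reduced C (us @ s # t # vs)" "xs \<approx> us @ s # t # vs" "[s, t] \<approx> [t, s]"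
  shows "bond C s t < 3"
proof (rule ccontr)
  assume "\<not> ?thesis"
  then have big: "3 \<le> bond C s t"
    by simp
  have g: "s \<in> gens C" "t \<in> gens C"
    using assms(2) by (auto simp: reduced_def)
  have *: "us @ s # t # vs \<approx> us @ t # s # vs"
    using weq_context[OF assms(4), of us vs] assms(2) by (simp add: reduced_def)
  then have "reduced C (us @ t # s # vs)" "xs \<approx> us @ t # s # vs"
    using reduced_same_length[OF assms(2) *] weq_trans[OF assms(3) *] by simp_all
  then have "filter (\<lambda>x. x = s \<or> x = t) (us @ s # t # vs) =
      filter (\<lambda>x. x = s \<or> x = t) (us @ t # s # vs)"
    using fc_filter[OF assms(1,2) _ assms(3), of "us @ t # s # vs" s t] g big by blast
  then have "s = t"
    by (metis (mono_tags, lifting) filter.simps(2) filter_append list.inject same_append_eq)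
  then show False
    using big bond_refl g by simp
qed

lemma left_descents_iff:
  assumes "set xs \<subseteq> gens C"
  shows "s \<in> left_descents C (word_elt C xs) \<longleftrightarrow> (\<exists>ys. reduced C (s # ys) \<and> xs \<approx> s # ys)"
proof
  assume *: "s \<in> left_descents C (word_elt C xs)"
  then have s: "s \<in> gens C"
    by (simp add: left_descents_def)
  obtain ys where ys: "reduced C ys" "s # xs \<approx> ys"
    using ex_reduced[of "s # xs"] assms s by auto
  obtain zs where zs: "reduced C zs" "xs \<approx> zs"
    using ex_reduced[OF assms] by blast
  have "length ys < length zs"
    using * len_word_elt[OF ys] len_word_elt[OF zs] mult_words(1)[OF assms s]
    by (simp add: left_descents_def)
  moreover have sy: "xs \<approx> s # ys"
    using weq_mult_left_iff[OF s assms] ys by blast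
  ultimately have "reduced C (s # ys)"
    using reduced_same_length[OF zs(1), of "s # ys"] weq_trans[OF weq_sym[OF zs(2)] sy] by simp
  with sy show "\<exists>ys. reduced C (s # ys) \<and> xs \<approx> s # ys"
    by blast
next
  assume "\<exists>ys. reduced C (s # ys) \<and> xs \<approx> s # ys"
  then obtain ys where ys: "reduced C (s # ys)" "xs \<approx> s # ys"
    by blast
  then have g: "s \<in> gens C" "set ys \<subseteq> gens C"
    by (auto simp: reduced_def)
  have "s # xs \<approx> ys"
    using weq_mult_left_iff[OF g(1), of ys xs] ys(2) g(2) weq_sym by blast
  then show "s \<in> left_descents C (word_elt C xs)"
    using len_word_elt[OF ys] len_word_elt[of ys "s # xs"] reduced_append[of "[s]" ys "[]"] ys(1)
      mult_words(1)[OF assms g(1)] g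
    by (simp add: left_descents_def)
qed

text \<open>Two successive left descents shorten the element by two, so the word starting with
  \<open>s t\<close> that they produce is reduced.\<close>

lemma left_reducible_iff:
  assumes "set xs \<subseteq> gens C"
  shows "left_weak_star_reducible C (word_elt C xs) s t \<longleftrightarrow>
    fc xs \<and> 3 \<le> bond C s t \<and> (\<exists>vs. reduced C (s # t # vs) \<and> xs \<approx> s # t # vs) \<and> \<not> fc (t # xs)"
    (is "?l \<longleftrightarrow> ?r")
proof
  assume l: ?l
  then have g: "s \<in> gens C" "t \<in> gens C"
    by (auto simp: left_weak_star_reducible_def)
  obtain ys where ys: "reduced C (s # ys)" "xs \<approx> s # ys"
    using l left_descents_iff[OF assms] by (auto simp: left_weak_star_reducible_def)
  have "t \<in> left_descents C (word_elt C (s # xs))"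
    using l mult_words(1)[OF assms g(1)] by (simp add: left_weak_star_reducible_def)
  then obtain vs where vs: "reduced C (t # vs)" "s # xs \<approx> t # vs"
    using left_descents_iff[of "s # xs" t] assms g by auto
  have xv: "xs \<approx> s # t # vs"
    using weq_mult_left_iff[OF g(1) assms] vs(2) by blast
  have "length ys = length (t # vs)"
  proof (rule reduced_weq_length)
    show "reduced C ys"
      using reduced_append[of "[s]" ys "[]"] ys(1) by simp
    show "ys \<approx> t # vs"
      using weq_mult_left_iff[OF g(1), of ys "xs"] weq_sym[OF ys(2)] ys(1) weq_trans vs(2)
      by (auto simp: reduced_def)
  qed (rule vs(1))
  then have "reduced C (s # t # vs)"
    using reduced_same_length[OF ys(1) weq_trans[OF weq_sym[OF ys(2)] xv]] by simp
  then show ?r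
    using l xv mult_words(1)[OF assms g(2)] by (auto simp: left_weak_star_reducible_def)
next
  assume r: ?r
  then obtain vs where vs: "reduced C (s # t # vs)" "xs \<approx> s # t # vs"
    by blast
  then have g: "s \<in> gens C" "t \<in> gens C" "set vs \<subseteq> gens C"
    by (auto simp: reduced_def)
  have "s # xs \<approx> t # vs"
    using weq_mult_left_iff[OF g(1), of "t # vs" xs] vs(2) g weq_sym by simp
  moreover have "reduced C (t # vs)"
    using reduced_append[of "[s]" "t # vs" "[]"] vs(1) by simp
  ultimately have "t \<in> left_descents C (word_elt C (s # xs))"
    using left_descents_iff[of "s # xs" t] assms g by auto
  moreover have "s \<in> left_descents C (word_elt C xs)"
    using left_descents_iff[OF assms] vs by blast
  ultimately show ?l
    using r g mult_words(1)[OF assms] by (auto simp: left_weak_star_reducible_def)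
qed

section \<open>Reversal and the right-hand notions\<close>

lemma reduced_rev_iff: "reduced C (rev xs) \<longleftrightarrow> reduced C xs"
proof -
  have "reduced C (rev ys)" if "reduced C ys" for ys
    using that weq_rev[of "rev ys"] unfolding reduced_def by fastforce
  from this[of xs] this[of "rev xs"] show ?thesis
    by auto
qed

lemma comms_rev:
  assumes "xs \<leadsto> ys" "set xs \<subseteq> gens C"
  shows "rev xs \<leadsto> rev ys"
  using assms(1)
proof (induction)
  case (step ys zs)
  have "set ys \<subseteq> gens C"
    using comms_weq[OF step.hyps(1) assms(2)] weq_gens by blast
  with step.hyps(2) have "comm_move C (rev ys) (rev zs)"
  proof cases
    case (1 s t us vs)
    then show ?thesis
      using comm_move.intros[of C t s "rev vs" "rev us"] bond_sym[of s t] \<open>set ys \<subseteq> gens C\<close>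
      by simp
  qed
  with step.IH show ?case
    by (rule rtranclp.rtrancl_into_rtrancl)
qed simp

lemma fc_rev:
  assumes "fc xs" "set xs \<subseteq> gens C"
  shows "fc (rev xs)"
proof -
  have "ys \<leadsto> zs" if "reduced C ys" "reduced C zs" "rev xs \<approx> ys" "rev xs \<approx> zs" for ys zs
  proof -
    have "rev ys \<leadsto> rev zs"
      using fc_comms[OF assms(1), of "rev ys" "rev zs"] that weq_rev[of "rev xs"]
      by (simp add: reduced_rev_iff)
    then show ?thesis
      using comms_rev[of "rev ys" "rev zs"] that(1) by (simp add: reduced_def)
  qed
  then show ?thesis
    using fc_iff[of "rev xs"] assms(2) by simp
qed

lemma len_rev:
  assumes "set xs \<subseteq> gens C"
  shows "len C (word_elt C (rev xs)) = len C (word_elt C xs)"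
proof -
  obtain ys where "reduced C ys" "xs \<approx> ys"
    using ex_reduced[OF assms] by blast
  then show ?thesis
    using len_word_elt[of ys xs] len_word_elt[of "rev ys" "rev xs"]
    by (simp add: reduced_rev_iff weq_rev)
qed

lemma right_descents_iff:
  assumes "set xs \<subseteq> gens C"
  shows "s \<in> right_descents C (word_elt C xs) \<longleftrightarrow> s \<in> left_descents C (word_elt C (rev xs))"
  using len_rev[of xs] len_rev[of "xs @ [s]"] assms mult_words(1)[of "rev xs" s]
    mult_words(2)[of xs s]
  by (auto simp: left_descents_def right_descents_def)

lemma right_reducible_iff:
  assumes "set xs \<subseteq> gens C"
  shows "right_weak_star_reducible C (word_elt C xs) s t \<longleftrightarrow>
    left_weak_star_reducible C (word_elt C (rev xs)) s t"
proof (cases "s \<in> gens C \<and> t \<in> gens C")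
  case True
  have "fc (rev ys) \<longleftrightarrow> fc ys" if "set ys \<subseteq> gens C" for ys
    using fc_rev[of ys] fc_rev[of "rev ys"] that by auto
  from this[of xs] this[of "xs @ [t]"] show ?thesis
    using True assms right_descents_iff[of xs s] right_descents_iff[of "xs @ [s]" t]
      mult_words(1)[of "rev xs"] mult_words(2)[of xs]
    by (simp add: left_weak_star_reducible_def right_weak_star_reducible_def)
qed (auto simp: left_weak_star_reducible_def right_weak_star_reducible_def)

lemma non_cancellable_iff:
  assumes "set xs \<subseteq> gens C"
  shows "non_cancellable C (word_elt C xs) \<longleftrightarrow> fc xs \<and>
    (\<forall>s t. \<not> left_weak_star_reducible C (word_elt C xs) s t \<and>
      \<not> left_weak_star_reducible C (word_elt C (rev xs)) s t)"
proof -
  have "s \<in> gens C \<and> t \<in> gens C" if "left_weak_star_reducible C w s t" for w s t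
    using that by (simp add: left_weak_star_reducible_def)
  then show ?thesis
    unfolding non_cancellable_def right_reducible_iff[OF assms] by blast
qed

section \<open>Braid factors and reducing prefixes\<close>

text \<open>Otherwise \<open>exchange\<close> yields a reduced word of the same element starting
  with \<open>t\<close> instead of \<open>s\<close>, so with a different \<open>s, t\<close>
  subword.\<close>

lemma fc_reduced_Cons:
  assumes "fc xs" "reduced C (s # ys)" "xs \<approx> s # ys" "t \<in> gens C" "3 \<le> bond C s t"
  shows "reduced C (t # s # ys)"
proof (rule ccontr)
  assume "\<not> ?thesis"
  then obtain as b bs where *: "s # ys = as @ b # bs" "t # s # ys \<approx> as @ bs"
    using exchange[OF assms(2,4)] by blast
  have s: "s \<in> gens C" and ys: "set (s # ys) \<subseteq> gens C"
    using assms(2) by (auto simp: reduced_def)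
  have "s # ys \<approx> t # as @ bs"
    using weq_mult_left_iff[OF assms(4) ys] *(2) by blast
  moreover have "length (t # as @ bs) = length (s # ys)"
    using *(1) by simp
  ultimately have "reduced C (t # as @ bs)" "xs \<approx> t # as @ bs"
    using reduced_same_length[OF assms(2)] assms(3) weq_trans by (force, blast)
  then have "filter (\<lambda>x. x = s \<or> x = t) (s # ys) = filter (\<lambda>x. x = s \<or> x = t) (t # as @ bs)"
    using fc_filter[OF assms(1,2) _ assms(3)] s assms(4,5) by blast
  then have "s = t"
    by simp
  then show False
    using assms(5) bond_refl[OF s] by simp
qed

text \<open>After prepending \<open>t\<close> the word is reduced and starts with one side of the
  braid relation. The other side gives a reduced word starting with \<open>s\<close>, so
  \<open>t w\<close> is not fully commutative. For bond 3 the word \<open>ws\<close> is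
  arbitrary.\<close>

lemma left_reducibleI:
  assumes "fc xs" "reduced C (s # t # vs)" "xs \<approx> s # t # vs"
    and "bond C s t = 3 \<or> bond C s t = 4 \<and> vs = s # ws"
  shows "left_weak_star_reducible C (word_elt C xs) s t"
proof -
  have g: "s \<in> gens C" "t \<in> gens C" "set vs \<subseteq> gens C" "set xs \<subseteq> gens C"
    using assms(2) weq_gens(1)[OF assms(3)] by (auto simp: reduced_def)
  have red: "reduced C (t # s # t # vs)"
    using fc_reduced_Cons[OF assms(1-3) g(2)] assms(4) by auto
  have eq: "t # xs \<approx> t # s # t # vs"
    using weq_context[OF assms(3), of "[t]" "[]"] g by simp
  obtain us where us: "t # s # t # vs \<approx> s # us" "length us = length (s # t # vs)"
  proof (cases "bond C s t = 3")
    case True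
    then have "t # s # t # vs \<approx> s # t # s # vs"
      using weq_context[OF weq_sym[OF braid_weq(2)], of s t "[]" vs] g by simp
    then show ?thesis
      using that by simp
  next
    case False
    then have "t # s # t # vs \<approx> s # t # s # t # ws"
      using weq_context[OF weq_sym[OF braid_weq(3)], of s t "[]" ws] g assms(4) by simp
    then show ?thesis
      using that False assms(4) by simp
  qed
  have "\<not> fc (t # xs)"
  proof
    assume "fc (t # xs)"
    then have "filter (\<lambda>x. x = s \<or> x = t) (t # s # t # vs) = filter (\<lambda>x. x = s \<or> x = t) (s # us)"
      using fc_filter[OF _ red _ eq weq_trans[OF eq us(1)], of s t]
        reduced_same_length[OF red us(1)] us(2) g assms(4)
      by auto
    then have "s = t"
      by simp
    then show False
      using bond_refl[of s] assms(4) g by auto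
  qed
  then show ?thesis
    using left_reducible_iff[OF g(4)] assms by auto
qed

text \<open>Exchanging a factor for an equal one of the same length gives another reduced word. The
  multiset separates the two sides of a braid relation of length 3; for length 4 the order of the
  letters is decisive.\<close>

lemma fc_no_braid:
  assumes "fc xs" "reduced C (us @ vs @ ws)" "xs \<approx> us @ vs @ ws" "vs \<approx> vs'" "length vs' = length vs"
  shows "mset vs = mset vs'"
    and "s \<in> gens C \<Longrightarrow> t \<in> gens C \<Longrightarrow> 3 \<le> bond C s t \<Longrightarrow>
      filter (\<lambda>x. x = s \<or> x = t) vs = filter (\<lambda>x. x = s \<or> x = t) vs'"
proof -
  have eq: "us @ vs @ ws \<approx> us @ vs' @ ws"
    using weq_context[OF assms(4), of us ws] assms(2) by (simp add: reduced_def)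
  have *: "reduced C (us @ vs' @ ws)" "xs \<approx> us @ vs' @ ws"
    using reduced_same_length[OF assms(2) eq] weq_trans[OF assms(3) eq] assms(5) by simp_all
  show "mset vs = mset vs'"
    using comm_moves_mset[OF fc_comms[OF assms(1,2) *(1) assms(3) *(2)]] by simp
  show "filter (\<lambda>x. x = s \<or> x = t) vs = filter (\<lambda>x. x = s \<or> x = t) vs'"
    if "s \<in> gens C" "t \<in> gens C" "3 \<le> bond C s t"
    using fc_filter[OF assms(1,2) *(1) assms(3) *(2) that] by simp
qed

section \<open>Irreducible elements\<close>

lemma commuting_product_iff:
  "commuting_product C w \<longleftrightarrow>
    (\<exists>xs. set xs \<subseteq> gens C \<and> distinct xs \<and> (\<forall>s\<in>set xs. \<forall>t\<in>set xs. [s, t] \<approx> [t, s]) \<and>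
      w = word_elt C xs)"
proof -
  have "(\<forall>s\<in>set xs. \<forall>t\<in>set xs. gen C s \<otimes>\<^bsub>cox_group C\<^esub> gen C t =
      gen C t \<otimes>\<^bsub>cox_group C\<^esub> gen C s) \<longleftrightarrow> (\<forall>s\<in>set xs. \<forall>t\<in>set xs. [s, t] \<approx> [t, s])"
    if "set xs \<subseteq> gens C" for xs
    using that gen_commute_iff by (simp add: subset_iff)
  then show ?thesis
    unfolding commuting_product_def Bex_def lists_eq_set mem_Collect_eq by blast
qed

text \<open>A reduction would provide a reduced word starting with \<open>s t\<close>. Its letters
  come from \<open>ps\<close> and hence commute, contrary to
  \<open>fc_commuting_factor\<close>.\<close>

lemma commuting_irreducible:
  assumes "xs \<approx> ps" "\<forall>s\<in>set ps. \<forall>t\<in>set ps. [s, t] \<approx> [t, s]"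
  shows "\<not> left_weak_star_reducible C (word_elt C xs) s t"
proof
  assume "left_weak_star_reducible C (word_elt C xs) s t"
  then obtain vs where vs: "fc xs" "3 \<le> bond C s t" "reduced C (s # t # vs)" "xs \<approx> s # t # vs"
    using left_reducible_iff[OF weq_gens(1)[OF assms(1)]] by blast
  obtain qs where qs: "subseq qs ps" "reduced C qs" "ps \<approx> qs"
    using deletion[OF weq_gens(2)[OF assms(1)]] by blast
  have "mset (s # t # vs) = mset qs"
    using comm_moves_mset[OF fc_comms[OF vs(1,3) qs(2) vs(4) weq_trans[OF assms(1) qs(3)]]] .
  then have "set (s # t # vs) = set qs"
    by (rule mset_eq_setD)
  then have "[s, t] \<approx> [t, s]"
    using assms(2) subseq_set_subset[OF qs(1)] by auto
  then show False
    using fc_commuting_factor[OF vs(1), of "[]" s t vs] vs by simp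
qed

lemma weq_move:
  assumes "\<forall>x\<in>set xs. [x, s] \<approx> [s, x]" "set xs \<subseteq> gens C" "s \<in> gens C"
  shows "xs @ [s] \<approx> s # xs"
  using assms
proof (induction xs)
  case (Cons x xs)
  have "[x] @ (xs @ [s]) @ [] \<approx> [x] @ (s # xs) @ []"
    using Cons by (intro weq_context) auto
  also have "[x] @ (s # xs) @ [] \<approx> s # x # xs"
    using weq_context[of "[x, s]" "[s, x]" "[]" xs] Cons.prems by simp
  finally show ?case
    by simp
qed (simp add: weq_refl)

text \<open>Passes from commuting in the group to bond 2: commutations within \<open>ps\<close> make
  the two letters adjacent, and \<open>fc_commuting_factor\<close> bounds the bond.\<close>

lemma fc_commuting_bond:
  assumes "fc xs" "reduced C (us @ ps)" "xs \<approx> us @ ps"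
    and "\<forall>s\<in>set ps. \<forall>t\<in>set ps. [s, t] \<approx> [t, s]"
    and "s \<in> set ps" "t \<in> set ps" "s \<noteq> t"
  shows "bond C s t = 2"
proof -
  have g: "set us \<subseteq> gens C" "set ps \<subseteq> gens C"
    using assms(2) by (auto simp: reduced_def)
  have *: "bond C x y = 2" if ps: "ps = as @ x # bs @ y # cs" and "x \<noteq> y" for x y as bs cs
  proof -
    have "bs @ [y] \<approx> y # bs"
      using assms(4) g ps by (intro weq_move) auto
    then have eq: "us @ ps \<approx> (us @ as) @ x # y # bs @ cs"
      using weq_context[of "bs @ [y]" "y # bs" "us @ as @ [x]" cs] g ps by simp
    have "bond C x y < 3"
      using fc_commuting_factor[OF assms(1) reduced_same_length[OF assms(2) eq]
          weq_trans[OF assms(3) eq]] assms(4) ps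
      by simp
    moreover have "bond C x y \<noteq> 1 \<and> 1 \<le> bond C x y"
      using coxeter_matrix g ps \<open>x \<noteq> y\<close> by (auto simp: coxeter_matrix_def)
    ultimately show ?thesis
      by simp
  qed
  obtain as bs where ps: "ps = as @ s # bs"
    using assms(5) by (meson split_list)
  then consider "t \<in> set as" | "t \<in> set bs"
    using assms(6,7) by auto
  then show ?thesis
  proof cases
    case 1
    then obtain as1 as2 where "as = as1 @ t # as2"
      by (meson split_list)
    then have "bond C t s = 2"
      using *[of as1 t as2 s bs] ps assms(7) by simp
    then show ?thesis
      using bond_sym[of s t] assms(5,6) g by auto
  next
    case 2
    then obtain bs1 bs2 where "bs = bs1 @ t # bs2"
      by (meson split_list)
    then show ?thesis
      using *[of as s bs1 t bs2] ps assms(7) by simp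
  qed
qed

lemma reduced_commuting_distinct:
  assumes "reduced C xs" "\<forall>s\<in>set xs. \<forall>t\<in>set xs. s \<noteq> t \<longrightarrow> bond C s t = 2"
  shows "distinct xs"
proof (rule ccontr)
  have g: "set xs \<subseteq> gens C"
    using assms(1) by (simp add: reduced_def)
  have comm: "[s, t] \<approx> [t, s]" if "s \<in> set xs" "t \<in> set xs" for s t
    using that assms(2) g braid_weq(1)[of s t] weq_refl[of "[s, s]"] by (cases "s = t") auto
  assume "\<not> distinct xs"
  then obtain as bs cs k where xs: "xs = as @ [k] @ bs @ [k] @ cs"
    using not_distinct_decomp by blast
  have "bs @ [k] \<approx> k # bs"
    using xs comm g by (intro weq_move) auto
  then have "xs \<approx> as @ k # k # bs @ cs"
    using weq_context[of "bs @ [k]" "k # bs" "as @ [k]" cs] g xs by simp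
  then have "reduced C (as @ k # k # bs @ cs)"
    using reduced_same_length[OF assms(1)] xs by simp
  then show False
    using reduced_no_square by blast
qed

text \<open>
  Every reduced word of the element below uses only the letters \<open>x\<close>, \<open>y\<close> and those of \<open>us\<close>; it
  splits into a word in \<open>x, y\<close> and a word in \<open>us\<close>, and as the two supports are disjoint, the two
  parts are determined separately.
\<close>

lemma fc_bond4_extend:
  assumes fc: "fc (x # y # us)" and red: "reduced C (x # y # us)" and bond: "bond C x y = 4"
    and far: "\<forall>u\<in>set us. bond C x u = 2 \<and> bond C y u = 2"
    and pair: "\<forall>u\<in>set us. \<forall>v\<in>set us. u \<noteq> v \<longrightarrow> bond C u v = 2"
    and even: "(\<forall>s\<in>gens C. s \<noteq> x \<longrightarrow> even (bond C x s)) \<or>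
      (\<forall>s\<in>gens C. s \<noteq> y \<longrightarrow> even (bond C y s))"
  shows "fc (y # x # y # us)"
proof -
  let ?W = "[y, x, y] @ us" and ?P = "\<lambda>z. z = x \<or> z = y"
  have g: "x \<in> gens C" "y \<in> gens C" "set us \<subseteq> gens C"
    using red by (auto simp: reduced_def)
  have W: "?W \<approx> ?W"
    using g by (intro weq_refl) auto
  have xy: "x \<noteq> y"
    using bond bond_refl g by auto
  have disj: "x \<notin> set us" "y \<notin> set us"
    using far bond_refl g by auto
  \<comment> \<open>Makes \<open>reduced_weq_support\<close>, which compares letters as group
    elements, an inclusion of letter sets.\<close>
  have unique: "z = i" if "[z] \<approx> [i]" "i \<in> {x, y} \<union> set us" for z i
  proof -
    have "i \<in> set (x # y # us)"
      using that by auto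
    then obtain as bs where "x # y # us = as @ i # bs"
      by (meson split_list)
    then show ?thesis
      using fc_letter_unique[OF fc, of as i bs z] red that(1) weq_refl[of "x # y # us"] g
      by (metis (no_types, lifting) reduced_def)
  qed
  have support: "set zs \<subseteq> set vs" if "reduced C zs" "zs \<approx> vs" "set vs \<subseteq> {x, y} \<union> set us" for zs vs
    using reduced_weq_support[OF that(1,2)] unique that(3) by fastforce
  have us: "reduced C us"
    using reduced_append[of "[x, y]" us "[]"] red by simp
  have normal: "ys \<leadsto> ?W" if ys: "reduced C ys" "?W \<approx> ys" for ys
  proof -
    define ys1 ys2 where "ys1 = filter ?P ys" and "ys2 = filter (\<lambda>z. \<not> ?P z) ys"
    have "set ys \<subseteq> set ?W"
      using support[OF ys(1) weq_sym[OF ys(2)]] by auto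
    then have sub: "set ys1 \<subseteq> {x, y}" "set ys2 \<subseteq> set us"
      by (auto simp: ys1_def ys2_def)
    have part: "ys \<leadsto> ys1 @ ys2"
      unfolding ys1_def ys2_def
    proof (intro comm_moves_partition ballI impI)
      fix a b
      assume "a \<in> set ys" "b \<in> set ys" "?P a" "\<not> ?P b"
      then have "b \<in> set us"
        using \<open>set ys \<subseteq> set ?W\<close> by auto
      then show "bond C b a = 2"
        using \<open>?P a\<close> far g bond_sym[of b a] by auto
    qed
    have parts: "reduced C (ys1 @ ys2)" "?W \<approx> ys1 @ ys2"
      using comms_reduced[OF part ys(1)] weq_trans[OF ys(2) comms_weq[OF part]] ys(1)
      by (auto simp: reduced_def)
    have red1: "reduced C ys1" and red2: "reduced C ys2"
      using reduced_append[of "[]" ys1 ys2] reduced_append[of ys1 ys2 "[]"] parts(1) by auto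
    have gs: "set ys1 \<subseteq> gens C" "set ys2 \<subseteq> gens C"
      using red1 red2 unfolding reduced_def by blast+
    \<comment> \<open>Separating the parts: the quotient of \<open>y x y\<close> by
      \<open>ys1\<close> equals that of \<open>ys2\<close> by \<open>us\<close>, so its support lies
      in \<open>{x, y}\<close> and in \<open>set us\<close>. These are disjoint, so it is
      trivial.\<close>
    have "[y, x, y] \<approx> ys1 @ ys2 @ rev us"
      using weq_rev_move[OF parts(2)] by simp
    then have "rev ys1 @ [y, x, y] \<approx> rev ys1 @ ys1 @ ys2 @ rev us"
      using weq_context[of _ _ "rev ys1" "[]"] gs by fastforce
    also have "rev ys1 @ ys1 @ ys2 @ rev us \<approx> ys2 @ rev us"
      using weq_cancel_rev[of "rev ys1" "[]" "ys2 @ rev us"] gs g by simp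
    finally have mid: "rev ys1 @ [y, x, y] \<approx> ys2 @ rev us" .
    obtain zs where zs: "reduced C zs" "ys2 @ rev us \<approx> zs"
      using ex_reduced[of "ys2 @ rev us"] gs g by auto
    have "set zs \<subseteq> {x, y}" "set zs \<subseteq> set us"
      using support[OF zs(1), of "rev ys1 @ [y, x, y]"] support[OF zs(1), of "ys2 @ rev us"]
        weq_sym[OF weq_trans[OF mid zs(2)]] weq_sym[OF zs(2)] sub by auto
    then have "zs = []"
      using disj by (cases zs) auto
    then have "ys2 @ rev us \<approx> []" "rev ys1 @ [y, x, y] \<approx> []"
      using zs(2) weq_trans[OF mid] by auto
    then have ys1: "[y, x, y] \<approx> ys1" and ys2: "ys2 \<approx> us"
      using weq_rev_move[of ys2 "rev us" "[]"] weq_rev[OF weq_rev_move[of "rev ys1" "[y, x, y]" "[]"]]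
        weq_sym by auto
    have "ys2 \<leadsto> us"
    proof (rule comm_moves_permute)
      have "set ys2 = set us"
        using support[OF red2 ys2] support[OF us weq_sym[OF ys2]] sub(2) by auto
      moreover show "distinct ys2"
        using sub(2) pair by (intro reduced_commuting_distinct red2) blast
      moreover have "distinct us"
        using pair by (intro reduced_commuting_distinct us) blast
      ultimately show "mset ys2 = mset us"
        using set_eq_iff_mset_eq_distinct by blast
      show "\<forall>u\<in>set ys2. \<forall>v\<in>set ys2. u \<noteq> v \<longrightarrow> bond C u v = 2"
        using sub(2) pair by blast
    qed
    moreover have "ys1 = [y, x, y]"
    proof -
      \<comment> \<open>Both the number of letters \<open>x\<close> and that of letters
        \<open>y\<close> change parity between \<open>y x y\<close> and either word, so whichever of
        the two is invariant suffices.\<close>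
      have parity: "\<not> [y, x, y] \<approx> [y]" "\<not> [y, x, y] \<approx> [x, y, x]"
        using even weq_parity[of "[y, x, y]" _ "\<lambda>z. z = x"] weq_parity[of "[y, x, y]" _ "\<lambda>z. z = y"]
          xy by fastforce+
      \<comment> \<open>Parity does not separate these; instead \<open>y x y = x\<close> would make
        \<open>x\<close> and \<open>y\<close> commute.\<close>
      have nx: "\<not> [y, x, y] \<approx> [x]"
      proof
        assume "[y, x, y] \<approx> [x]"
        then have "[y, x] \<approx> [x, y]"
          using weq_rev_move[of "[y, x]" "[y]" "[x]"] by simp
        then show False
          using fc_commuting_factor[OF fc, of "[]" x y us] red bond weq_refl[of "x # y # us"] g weq_sym
          by simp
      qed
      have "length ys1 \<le> 3" "odd (length ys1)"
        using red1 weq_sym[OF ys1] weq_even_length[OF ys1] unfolding reduced_def by fastforce+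
      moreover from this have "length ys1 = 0 \<or> length ys1 = 1 \<or> length ys1 = 2 \<or> length ys1 = 3"
        by linarith
      ultimately have "length ys1 = 1 \<or> length ys1 = 3"
        by auto
      then consider a where "ys1 = [a]" | a b c where "ys1 = [a, b, c]"
        unfolding One_nat_def numeral_3_eq_3 length_Suc_conv length_0_conv by blast
      then show ?thesis
      proof cases
        case 1
        then show ?thesis
          using ys1 sub(1) parity(1) nx by auto
      next
        case 2
        then have "a \<noteq> b" "b \<noteq> c"
          using red1 reduced_no_square[of "[]" a "[c]"] reduced_no_square[of "[a]" b "[]"] by auto
        then show ?thesis
          using 2 ys1 sub(1) parity(2) by auto
      qed
    qed
    ultimately have "ys1 @ ys2 \<leadsto> ?W"
      using comm_moves_context[of C ys2 us "[y, x, y]" "[]"] by simp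
    then show ?thesis
      using part by (meson rtranclp_trans)
  qed
  have "ys \<leadsto> zs" if "reduced C ys" "reduced C zs" "?W \<approx> ys" "?W \<approx> zs" for ys zs
    using normal[OF that(1,3)] comms_sym[OF normal[OF that(2,4)]] that(2)
    by (meson reduced_def rtranclp_trans)
  then show ?thesis
    using fc_iff[of "y # x # y # us"] g by simp
qed

text \<open>Letters of \<open>us\<close> have bond 2 with all other letters of the word, so
  \<open>{s, t} = {x, y}\<close>; the order in the \<open>x, y\<close> subword forces
  \<open>s = x\<close> and \<open>t = y\<close>. Then \<open>t w = y x y u\<close> is fully
  commutative by \<open>fc_bond4_extend\<close>.\<close>

lemma bond4_irreducible:
  assumes fc: "fc xs" and xs: "xs \<approx> x # y # us" and red: "reduced C (x # y # us)"
    and bond: "bond C x y = 4"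
    and far: "\<forall>u\<in>set us. bond C x u = 2 \<and> bond C y u = 2"
    and pair: "\<forall>u\<in>set us. \<forall>v\<in>set us. u \<noteq> v \<longrightarrow> bond C u v = 2"
    and even: "(\<forall>s\<in>gens C. s \<noteq> x \<longrightarrow> even (bond C x s)) \<or>
      (\<forall>s\<in>gens C. s \<noteq> y \<longrightarrow> even (bond C y s))"
  shows "\<not> left_weak_star_reducible C (word_elt C xs) s t"
proof
  assume "left_weak_star_reducible C (word_elt C xs) s t"
  then obtain vs where vs: "3 \<le> bond C s t" "reduced C (s # t # vs)" "xs \<approx> s # t # vs"
      "\<not> fc (t # xs)"
    using left_reducible_iff[OF weq_gens(1)[OF xs]] by blast
  have g: "x \<in> gens C" "y \<in> gens C" "set us \<subseteq> gens C" "s \<in> gens C" "t \<in> gens C"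
    using red vs(2) by (auto simp: reduced_def)
  have disj: "x \<notin> set us" "y \<notin> set us" "x \<noteq> y" "s \<noteq> t"
    using far bond_refl g bond vs(1) by auto
  have "mset (s # t # vs) = mset (x # y # us)"
    using comm_moves_mset[OF fc_comms[OF fc vs(2) red vs(3) xs]] .
  then have "set (s # t # vs) = set (x # y # us)"
    by (rule mset_eq_setD)
  then have "{s, t} \<subseteq> {x, y} \<union> set us"
    by auto
  moreover have "s \<notin> set us"
  proof
    assume "s \<in> set us"
    then have "bond C s t = 2"
      using calculation pair far bond_sym[of s t] g disj(4) by auto
    then show False
      using vs(1) by simp
  qed
  moreover have "t \<notin> set us"
  proof
    assume "t \<in> set us"
    then have "bond C s t = 2"
      using calculation(1) pair far bond_sym[of s t] g disj(4) by auto
    then show False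
      using vs(1) by simp
  qed
  ultimately have "{s, t} = {x, y}"
    using disj(4) by auto
  moreover have "filter (\<lambda>z. z = x \<or> z = y) (s # t # vs) = filter (\<lambda>z. z = x \<or> z = y) (x # y # us)"
    using fc_filter[OF fc vs(2) red vs(3) xs g(1,2)] bond by simp
  ultimately have "t = y"
    using disj by (auto simp: doubleton_eq_iff)
  moreover have "y # xs \<approx> y # x # y # us"
    using weq_context[OF xs, of "[y]" "[]"] g by simp
  ultimately show False
    using vs(4) fc_cong fc_bond4_extend[OF _ red bond far pair even] fc fc_cong[OF xs] by blast
qed

end

section \<open>The classification\<close>

text \<open>
  The labelling \<open>p\<close> treats \<open>B\<^sub>n\<close> and \<open>B'\<^sub>n\<close> uniformly. It is injective up to \<open>n + 1\<close> so that \<open>p 3\<close> is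
  not a generator for \<open>n = 2\<close>.
\<close>

locale labelled_typeB = coxeter_system C for C :: "'a coxeter" +
  fixes n :: nat and p :: "nat \<Rightarrow> 'a"
  assumes two_le: "2 \<le> n"
    and inj: "inj_on p {1..n + 1}"
    and gens: "gens C = p ` {1..n}"
    and bond: "i \<in> {1..n} \<Longrightarrow> j \<in> {1..n} \<Longrightarrow> bond C (p i) (p j) = bond (typeB n) i j"
begin

lemma map_gens: "set zs \<subseteq> {1..n} \<Longrightarrow> set (map p zs) \<subseteq> gens C"
  by (auto simp: gens)

lemma inj_letters: "inj_on p {1..n}"
  using inj by (rule inj_on_subset) auto

lemma bond_far:
  "i \<in> {1..n} \<Longrightarrow> j \<in> {1..n} \<Longrightarrow> i + 2 \<le> j \<or> j + 2 \<le> i \<Longrightarrow> bond C (p i) (p j) = 2"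
  by (simp add: bond bond_typeB)

lemma bond_near:
  "2 \<le> i \<Longrightarrow> Suc i \<le> n \<Longrightarrow> bond C (p i) (p (Suc i)) = 3"
  "2 \<le> i \<Longrightarrow> Suc i \<le> n \<Longrightarrow> bond C (p (Suc i)) (p i) = 3"
  "bond C (p 1) (p 2) = 4" "bond C (p 2) (p 1) = 4"
  using two_le by (simp_all add: bond) (auto simp: typeB_def doubleton_eq_iff)

lemma low_gens: "p 1 \<in> gens C" "p 2 \<in> gens C"
  using two_le by (auto simp: gens)

text \<open>The other generators have bond 4 or 2 with \<open>p 1\<close>, so by
  \<open>weq_parity\<close> the number of letters \<open>p 1\<close> modulo 2 is an
  invariant.\<close>

lemma bond_even: "s \<in> gens C \<Longrightarrow> s \<noteq> p 1 \<Longrightarrow> even (bond C (p 1) s)"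
  using two_le by (auto simp: gens bond) (auto simp: typeB_def doubleton_eq_iff)

text \<open>The reduced words of the element represented by \<open>xs\<close>, written in labels;
  this is the set \<open>R\<close> of the combinatorial locales.\<close>

definition labels :: "'a list \<Rightarrow> nat list set" where
  "labels xs = {zs. set zs \<subseteq> {1..n} \<and> reduced C (map p zs) \<and> xs \<approx> map p zs}"

lemma labels_rev: "rev ` labels xs = labels (rev xs)"
proof -
  have *: "rev zs \<in> labels (rev ys)" if "zs \<in> labels ys" for zs ys
    using that weq_rev[of ys] by (auto simp: labels_def reduced_rev_iff simp flip: rev_map)
  show ?thesis
  proof
    show "rev ` labels xs \<subseteq> labels (rev xs)"
      using * by blast
    show "labels (rev xs) \<subseteq> rev ` labels xs"
    proof
      fix zs
      assume "zs \<in> labels (rev xs)"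
      then have "rev zs \<in> labels xs"
        using *[of zs "rev xs"] by simp
      then show "zs \<in> rev ` labels xs"
        by (metis image_eqI rev_rev_ident)
    qed
  qed
qed

lemma comm_move_map:
  assumes "comm_move (typeB n) zs zs'" "set zs \<subseteq> {1..n}"
  shows "comm_move C (map p zs) (map p zs')"
  using assms(1)
proof cases
  case (1 i j us vs)
  then have "bond C (p i) (p j) = 2"
    using assms(2) by (simp add: bond)
  then show ?thesis
    using comm_move.intros[of C "p i" "p j" "map p us" "map p vs"] 1 by simp
qed

text \<open>Squares contradict reducedness, braid factors contradict \<open>fc_no_braid\<close>, and
  the forbidden prefixes are the situations of \<open>left_reducibleI\<close>.\<close>

lemma left_noncancellable_labels:
  assumes "fc xs" "\<forall>s t. \<not> left_weak_star_reducible C (word_elt C xs) s t"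
  shows "left_noncancellable_class n (labels xs)"
proof
  show "set zs \<subseteq> {1..n}" if "zs \<in> labels xs" for zs
    using that by (simp add: labels_def)
  show "zs' \<in> labels xs" if zs: "zs \<in> labels xs" "comm_move (typeB n) zs zs'" for zs zs'
  proof -
    have *: "map p zs \<leadsto> map p zs'"
      using comm_move_map[OF zs(2)] zs(1) by (auto simp: labels_def)
    have "set zs' = set zs"
      using comm_moves_mset[of "typeB n" zs zs'] zs(2) by (metis mset_eq_setD r_into_rtranclp)
    then show ?thesis
      using zs(1) comms_reduced[OF *] comms_weq[OF *] weq_trans
      by (auto simp: labels_def reduced_def)
  qed
  show "us @ i # i # vs \<notin> labels xs" for us i vs
    using reduced_no_square by (auto simp: labels_def)
  have near: "Suc i \<le> n" "p i \<in> gens C" "p (Suc i) \<in> gens C" "p i \<noteq> p (Suc i)"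
    if "zs \<in> labels xs" "i \<in> set zs" "Suc i \<in> set zs" for zs i
  proof -
    have "i \<in> {1..n}" "Suc i \<in> {1..n}"
      using that by (auto simp: labels_def)
    then show "Suc i \<le> n" "p i \<in> gens C" "p (Suc i) \<in> gens C" "p i \<noteq> p (Suc i)"
      using inj_letters by (auto simp: gens inj_on_eq_iff)
  qed
  have braid: False if "us @ [i, j, i] @ vs \<in> labels xs" "j = Suc i \<and> 2 \<le> i \<or> i = Suc j \<and> 2 \<le> j"
    for us vs i j
  proof -
    have ij: "p i \<in> gens C" "p j \<in> gens C" "p i \<noteq> p j" "bond C (p i) (p j) = 3"
      using near[OF that(1), of i] near[OF that(1), of j] that(2) bond_near(1)[of i]
        bond_near(2)[of j] by auto
    have "reduced C (map p us @ [p i, p j, p i] @ map p vs)"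
      "xs \<approx> map p us @ [p i, p j, p i] @ map p vs"
      using that(1) by (simp_all add: labels_def)
    then have "mset [p i, p j, p i] = mset [p j, p i, p j]"
      by (rule fc_no_braid(1)[OF assms(1) _ _ braid_weq(2)[OF ij(1,2,4)]]) simp
    then have "count (mset [p i, p j, p i]) (p i) = count (mset [p j, p i, p j]) (p i)"
      by simp
    then show False
      using ij(3) by simp
  qed
  show "us @ i # Suc i # i # vs \<notin> labels xs" if "2 \<le> i" for us i vs
    using braid[of us i "Suc i" vs] that by auto
  show "us @ Suc i # i # Suc i # vs \<notin> labels xs" if "2 \<le> i" for us i vs
    using braid[of us "Suc i" i vs] that by auto
  have ne: "p 1 \<noteq> p 2"
    using inj_letters two_le by (auto simp: inj_on_eq_iff)
  show "us @ 1 # 2 # 1 # 2 # vs \<notin> labels xs" for us vs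
  proof
    assume *: "us @ 1 # 2 # 1 # 2 # vs \<in> labels xs"
    then have "reduced C (map p us @ [p 1, p 2, p 1, p 2] @ map p vs)"
      "xs \<approx> map p us @ [p 1, p 2, p 1, p 2] @ map p vs"
      by (simp_all add: labels_def)
    then have "filter (\<lambda>x. x = p 1 \<or> x = p 2) [p 1, p 2, p 1, p 2] =
        filter (\<lambda>x. x = p 1 \<or> x = p 2) [p 2, p 1, p 2, p 1]"
      using bond_near(3)
      by (intro fc_no_braid(2)[OF assms(1) _ _ braid_weq(3)[OF low_gens bond_near(3)]] low_gens)
        simp_all
    then show False
      using ne by (metis (mono_tags, lifting) filter.simps(2) list.inject)
  qed
  have prefix: False
    if "i # j # vs \<in> labels xs" "bond C (p i) (p j) = 3 \<or> bond C (p i) (p j) = 4 \<and> vs = i # ws"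
    for i j vs ws
    using left_reducibleI[OF assms(1), of "p i" "p j" "map p vs" "map p ws"] assms(2) that
    by (auto simp: labels_def)
  show "i # Suc i # vs \<notin> labels xs" if "2 \<le> i" for i vs
    using prefix[of i "Suc i" vs] near(1)[of _ i] bond_near(1)[of i] that by fastforce
  show "Suc i # i # vs \<notin> labels xs" if "2 \<le> i" for i vs
    using prefix[of "Suc i" i vs] near(1)[of _ i] bond_near(2)[of i] that by fastforce
  show "1 # 2 # 1 # vs \<notin> labels xs" "2 # 1 # 2 # vs \<notin> labels xs" for vs
    using prefix[of 1 2 "1 # vs" vs] prefix[of 2 1 "2 # vs" vs] bond_near(3,4) by auto
qed

definition bond4_product :: "'a list set \<Rightarrow> bool" where
  "bond4_product w \<longleftrightarrow> (\<exists>u. commuting_product C u \<and>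
     p 1 \<notin> supp C u \<and> p 2 \<notin> supp C u \<and> p 3 \<notin> supp C u \<and>
     (w = gen C (p 1) \<otimes>\<^bsub>cox_group C\<^esub> gen C (p 2) \<otimes>\<^bsub>cox_group C\<^esub> u \<or>
      w = gen C (p 2) \<otimes>\<^bsub>cox_group C\<^esub> gen C (p 1) \<otimes>\<^bsub>cox_group C\<^esub> u))"

lemma gen_mult_mult:
  assumes "s \<in> gens C" "t \<in> gens C" "set us \<subseteq> gens C"
  shows "gen C s \<otimes>\<^bsub>cox_group C\<^esub> gen C t \<otimes>\<^bsub>cox_group C\<^esub> word_elt C us = word_elt C (s # t # us)"
proof -
  have "gen C s \<otimes>\<^bsub>cox_group C\<^esub> gen C t = word_elt C [s, t]"
    using mult_words(1)[of "[t]" s] assms by (simp add: gen_def)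
  then show ?thesis
    using mult_word_elt[of "[s, t]" C us] assms by (auto simp: in_lists_conv_set)
qed

lemma non_cancellable_imp:
  assumes "set xs \<subseteq> gens C" "non_cancellable C (word_elt C xs)"
  shows "commuting_product C (word_elt C xs) \<or> bond4_product (word_elt C xs)"
proof -
  have fc: "fc xs" and irr: "\<forall>s t. \<not> left_weak_star_reducible C (word_elt C xs) s t"
    "\<forall>s t. \<not> left_weak_star_reducible C (word_elt C (rev xs)) s t"
    using assms non_cancellable_iff by auto
  interpret noncancellable_class n "labels xs"
    using left_noncancellable_labels[OF fc irr(1)]
      left_noncancellable_labels[OF fc_rev[OF fc assms(1)] irr(2)]
    by (simp add: noncancellable_class_def labels_rev)
  obtain ys where ys: "reduced C ys" "xs \<approx> ys"
    using ex_reduced[OF assms(1)] by blast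
  then have "ys \<in> lists (p ` {1..n})"
    by (auto simp: reduced_def gens)
  then obtain zs where "set zs \<subseteq> {1..n}" "ys = map p zs"
    unfolding lists_image by auto
  then have zs: "zs \<in> labels xs"
    using ys by (simp add: labels_def)
  have comm_prod: "commuting_product C (word_elt C (map p us))"
    if "set us \<subseteq> {1..n}" "distinct us"
      and far: "\<forall>x\<in>set us. \<forall>y\<in>set us. x \<noteq> y \<longrightarrow> x + 2 \<le> y \<or> y + 2 \<le> x" for us
  proof -
    have "[p i, p j] \<approx> [p j, p i]" if ij: "i \<in> set us" "j \<in> set us" for i j
    proof (cases "i = j")
      case True
      then show ?thesis
        using \<open>set us \<subseteq> {1..n}\<close> ij by (auto simp: gens intro!: weq_refl)
    next
      case False
      then show ?thesis
        using \<open>set us \<subseteq> {1..n}\<close> ij far by (intro braid_weq(1) bond_far) (auto simp: gens)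
    qed
    moreover have "distinct (map p us)"
      using that inj_letters by (simp add: distinct_map inj_on_subset)
    ultimately show ?thesis
      unfolding commuting_product_iff using map_gens[OF that(1)]
      by (intro exI[of _ "map p us"]) auto
  qed
  from zs show ?thesis
  proof (cases rule: normal_form)
    case commuting
    then have "commuting_product C (word_elt C (map p zs))"
      using zs comm_prod[of zs] by (simp add: labels_def)
    then show ?thesis
      using zs word_elt_eq_weq[of xs "map p zs"] assms(1) by (auto simp: labels_def reduced_def)
  next
    case (bond4 x y us)
    let ?us = "map p us"
    have xy: "x \<in> {1, 2}" "y \<in> {1, 2}" and red: "reduced C (p x # p y # ?us)"
      and eq: "xs \<approx> p x # p y # ?us" and us: "set us \<subseteq> {1..n}"
      using bond4(1,2) by (auto simp: labels_def)
    have g: "p x \<in> gens C" "p y \<in> gens C" "set ?us \<subseteq> gens C"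
      using red by (auto simp: reduced_def)
    \<comment> \<open>The support ranges over all reduced words. Putting \<open>p x\<close> and
      \<open>p y\<close> in front of such a word makes it a reduced word of the fully commutative
      element, so its letters are those of \<open>?us\<close>.\<close>
    have supp: "s \<in> p ` set us" if s: "s \<in> supp C (word_elt C ?us)" for s
    proof -
      obtain vs where vs: "reduced C vs" "?us \<approx> vs" "s \<in> set vs"
        using s reduced_expr_iff[OF g(3)] unfolding supp_def by blast
      have "reduced C ?us"
        using reduced_append[of "[p x, p y]" ?us "[]"] red by simp
      then have len: "length vs = length ?us"
        using reduced_weq_length vs by metis
      have ext: "p x # p y # ?us \<approx> p x # p y # vs"
        using weq_context[OF vs(2), of "[p x, p y]" "[]"] g by simp
      have "mset (p x # p y # ?us) = mset (p x # p y # vs)"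
        using reduced_same_length[OF red ext] len
        by (intro comm_moves_mset[OF fc_comms[OF fc red _ eq weq_trans[OF eq ext]]]) simp
      then have "mset ?us = mset vs"
        by simp
      then have "set ?us = set vs"
        by (rule mset_eq_setD)
      then show ?thesis
        using vs(3) by simp
    qed
    have "p k \<notin> supp C (word_elt C ?us)" if "k \<in> {1, 2, 3}" for k
    proof
      assume "p k \<in> supp C (word_elt C ?us)"
      then obtain u where u: "u \<in> set us" "p k = p u"
        using supp by blast
      then have "4 \<le> u" "u \<le> n"
        using bond4(4) us by auto
      then have "k = u"
        using inj_onD[OF inj u(2)] that by auto
      then show False
        using \<open>4 \<le> u\<close> that by auto
    qed
    moreover have "commuting_product C (word_elt C ?us)"
      using comm_prod[of us] us bond4(3,4) by blast
    moreover have "word_elt C xs = word_elt C (p x # p y # ?us)"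
      using word_elt_eq_weq[of xs "p x # p y # ?us"] assms(1) eq g by simp
    ultimately have "bond4_product (word_elt C xs)"
      unfolding bond4_product_def using bond4(2) gen_mult_mult[OF g]
      by (intro exI[of _ "word_elt C ?us"]) auto
    then show ?thesis ..
  qed
qed

section \<open>The converse direction and the classification\<close>

lemma commuting_non_cancellable:
  assumes "fc xs" "xs \<approx> ps" "\<forall>s\<in>set ps. \<forall>t\<in>set ps. [s, t] \<approx> [t, s]"
  shows "non_cancellable C (word_elt C xs)"
  using commuting_irreducible[OF assms(2,3)] commuting_irreducible[OF weq_rev[OF assms(2)]]
    non_cancellable_iff[OF weq_gens(1)[OF assms(2)]] assms(1,3)
  by simp

text \<open>The word \<open>a # b # us\<close> need not be reduced, so one passes to a reduced
  subword. Either it misses \<open>a\<close> or \<open>b\<close>, and then all its letters commute,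
  or it is \<open>a # b # vs\<close> and \<open>bond4_irreducible\<close> applies on both
  sides.\<close>

lemma non_cancellable_if_bond4:
  assumes fc: "fc xs" and xs: "xs \<approx> a # b # us" and us: "reduced C us"
    and comm: "\<forall>s\<in>set us. \<forall>t\<in>set us. [s, t] \<approx> [t, s]"
    and ab: "(a, b) = (p 1, p 2) \<or> (a, b) = (p 2, p 1)"
    and avoid: "p 1 \<notin> set us" "p 2 \<notin> set us" "p 3 \<notin> set us"
  shows "non_cancellable C (word_elt C xs)"
proof -
  have g: "a \<in> gens C" "b \<in> gens C" "set us \<subseteq> gens C" "set xs \<subseteq> gens C"
    using weq_gens[OF xs] by auto
  have far: "bond C a u = 2 \<and> bond C b u = 2" if u: "u \<in> set us" for u
  proof -
    obtain i where i: "u = p i" "i \<in> {1..n}"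
      using u g gens by auto
    then have "i \<noteq> 1" "i \<noteq> 2" "i \<noteq> 3" "1 \<le> i"
      using u avoid by auto
    then have "4 \<le> i"
      by linarith
    then have "bond C (p 1) (p i) = 2" "bond C (p 2) (p i) = 2"
      using i(2) two_le by (auto intro!: bond_far)
    then show ?thesis
      using ab i(1) by auto
  qed
  have comm1: "\<forall>s\<in>set (c # us). \<forall>t\<in>set (c # us). [s, t] \<approx> [t, s]" if c: "c = a \<or> c = b" for c
  proof -
    have "c \<in> gens C"
      using c g by auto
    moreover have "[c, t] \<approx> [t, c]" if "t \<in> set us" for t
      using braid_weq(1)[of c t] far[OF that] c g that by auto
    ultimately show ?thesis
      using comm weq_refl[of "[c, c]"] weq_sym by auto
  qed
  obtain qs where qs: "subseq qs (a # b # us)" "reduced C qs" "a # b # us \<approx> qs"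
    using deletion[OF weq_gens(2)[OF xs]] by blast
  have xq: "xs \<approx> qs"
    using weq_trans[OF xs qs(3)] .
  have "(\<exists>c. c \<in> {a, b} \<and> set qs \<subseteq> set (c # us)) \<or> (\<exists>vs. qs = a # b # vs \<and> subseq vs us)"
    using subseq_Cons_cases[OF qs(1)] subseq_Cons_cases[of _ b us] subseq_set_subset
    by (metis insertCI insert_mono list.simps(15))
  then show ?thesis
  proof (elim disjE exE conjE)
    fix c
    assume "c \<in> {a, b}" "set qs \<subseteq> set (c # us)"
    then show ?thesis
      using commuting_non_cancellable[OF fc xq] comm1[of c] by (metis insertE singletonD subsetD)
  next
    fix vs
    assume vs: "qs = a # b # vs" "subseq vs us"
    have sub: "set vs \<subseteq> set us"
      using subseq_set_subset[OF vs(2)] .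
    have "\<forall>s\<in>set vs. \<forall>t\<in>set vs. [s, t] \<approx> [t, s]"
      using comm sub by blast
    then have pair: "\<forall>u\<in>set vs. \<forall>v\<in>set vs. u \<noteq> v \<longrightarrow> bond C u v = 2"
      using fc_commuting_bond[OF fc, of "[a, b]" vs] qs(2) xq vs(1) by simp
    have bond4: "bond C a b = 4" "bond C b a = 4"
      using ab bond_near(3,4) by auto
    have even: "(\<forall>s\<in>gens C. s \<noteq> a \<longrightarrow> even (bond C a s)) \<or> (\<forall>s\<in>gens C. s \<noteq> b \<longrightarrow> even (bond C b s))"
      using bond_even ab by auto
    have left: "\<not> left_weak_star_reducible C (word_elt C xs) s t" for s t
      using bond4_irreducible[OF fc, of a b vs s t] xq qs(2) vs(1) bond4(1) far sub pair even by blast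
    \<comment> \<open>The reversed word commutes into \<open>b # a # rev vs\<close>, of the same
      shape with \<open>a\<close> and \<open>b\<close> interchanged, which settles the right
      side.\<close>
    have part: "rev vs @ [b, a] \<leadsto> [b, a] @ rev vs"
    proof -
      have "bond C u a = 2 \<and> bond C u b = 2" if "u \<in> set vs" for u
      proof -
        have "u \<in> set us" "u \<in> gens C"
          using that sub g by blast+
        then show ?thesis
          using far[of u] g bond_sym[of a u] bond_sym[of b u] by simp
      qed
      then have 1: "rev vs @ [b] \<leadsto> b # rev vs" "rev vs @ [a] \<leadsto> a # rev vs"
        by (auto intro!: comm_moves_left)
      show ?thesis
        using comm_moves_context[OF 1(1), of "[]" "[a]"] comm_moves_context[OF 1(2), of "[b]" "[]"]
        by simp
    qed
    have rq: "rev xs \<approx> rev vs @ [b, a]" "reduced C (rev vs @ [b, a])"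
      using weq_rev[OF xq] qs(2) vs(1) reduced_rev_iff[of qs] by simp_all
    then have "rev xs \<approx> b # a # rev vs" "reduced C (b # a # rev vs)"
      using weq_trans[OF rq(1) comms_weq[OF part]] comms_reduced[OF part] by (simp_all add: reduced_def)
    then have right: "\<not> left_weak_star_reducible C (word_elt C (rev xs)) s t" for s t
      using bond4_irreducible[OF fc_rev[OF fc g(4)], of b a "rev vs" s t] bond4(2) far sub pair even
      by auto
    show ?thesis
      using non_cancellable_iff[OF g(4)] fc left right by blast
  qed
qed

theorem non_cancellable_classification:
  assumes "fully_commutative C w"
  shows "non_cancellable C w \<longleftrightarrow> commuting_product C w \<or> bond4_product w"
proof -
  obtain xs where xs: "set xs \<subseteq> gens C" "w = word_elt C xs"
    using assms by (auto simp: fully_commutative_def carrier_cox_group)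
  have "non_cancellable C w" if comm: "commuting_product C w"
  proof -
    obtain ps where ps: "set ps \<subseteq> gens C" "\<forall>s\<in>set ps. \<forall>t\<in>set ps. [s, t] \<approx> [t, s]"
        "w = word_elt C ps"
      using comm commuting_product_iff by blast
    then have "xs \<approx> ps"
      using xs word_elt_eq_weq by metis
    then show ?thesis
      using commuting_non_cancellable[of xs ps] assms xs(2) ps(2) by blast
  qed
  moreover have "non_cancellable C w" if bond4: "bond4_product w"
  proof -
    obtain u a b where u: "commuting_product C u" "p 1 \<notin> supp C u" "p 2 \<notin> supp C u"
        "p 3 \<notin> supp C u" and ab: "(a, b) = (p 1, p 2) \<or> (a, b) = (p 2, p 1)"
        and w: "w = gen C a \<otimes>\<^bsub>cox_group C\<^esub> gen C b \<otimes>\<^bsub>cox_group C\<^esub> u"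
      using bond4 unfolding bond4_product_def by blast
    obtain ps where ps: "set ps \<subseteq> gens C" "\<forall>s\<in>set ps. \<forall>t\<in>set ps. [s, t] \<approx> [t, s]"
        "u = word_elt C ps"
      using u(1) commuting_product_iff by blast
    \<comment> \<open>A commuting product need not be given by a reduced word; the letters of the
      reduced subword \<open>us\<close> lie in the support, so the support conditions apply.\<close>
    obtain us where us: "subseq us ps" "reduced C us" "ps \<approx> us"
      using deletion[OF ps(1)] by blast
    have g: "a \<in> gens C" "b \<in> gens C"
      using ab low_gens by auto
    have sub: "set us \<subseteq> supp C u"
      using reduced_expr_iff[OF ps(1)] us ps(3) by (auto simp: supp_def)
    have "xs \<approx> a # b # ps"
      using gen_mult_mult[OF g ps(1)] w xs ps g word_elt_eq_weq[of xs "a # b # ps"] by simp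
    also have "a # b # ps \<approx> a # b # us"
      using weq_context[OF us(3), of "[a, b]" "[]"] g by simp
    finally have "xs \<approx> a # b # us" .
    then show ?thesis
      using non_cancellable_if_bond4[of xs a b us] assms xs(2) us(2) ab sub u(2-4) ps(2)
        subseq_set_subset[OF us(1)]
      by blast
  qed
  ultimately show ?thesis
    using non_cancellable_imp[OF xs(1)] xs(2) by blast
qed

end

section \<open>The labellings of the two types\<close>

lemma labelled_typeB: "2 \<le> n \<Longrightarrow> labelled_typeB (typeB n) n (\<lambda>i. i)"
  by unfold_locales (auto simp: coxeter_matrix_typeB, auto simp: typeB_def)

text \<open>Reflecting the diagram by \<open>i\<close> to \<open>n + 2 - i\<close> sends 1, 2, 3 to
  \<open>n + 1\<close>, \<open>n\<close>, \<open>n - 1\<close> and the bond of 1 and 2 to that of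
  \<open>n + 1\<close> and \<open>n\<close>.\<close>

lemma labelled_typeB':
  assumes "2 \<le> n"
  shows "labelled_typeB (typeB' n) n (\<lambda>i. n + 2 - i)"
proof
  show "coxeter_matrix (typeB' n)"
    by (rule coxeter_matrix_typeB')
  show "2 \<le> n"
    by (rule assms)
  show "inj_on (\<lambda>i. n + 2 - i) {1..n + 1}"
    by (auto simp: inj_on_def)
  show "gens (typeB' n) = (\<lambda>i. n + 2 - i) ` {1..n}"
  proof -
    have "j \<in> (\<lambda>i. n + 2 - i) ` {1..n}" if "2 \<le> j" "j \<le> n + 1" for j
      using that by (intro image_eqI[of _ _ "n + 2 - j"]) auto
    then show ?thesis
      by (auto simp: typeB'_def)
  qed
  show "bond (typeB' n) (n + 2 - i) (n + 2 - j) = bond (typeB n) i j"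
    if "i \<in> {1..n}" "j \<in> {1..n}" for i j
  proof -
    have "n + 2 - i = n + 2 - j \<longleftrightarrow> i = j"
      "{n + 2 - i, n + 2 - j} = {n, n + 1} \<longleftrightarrow> {i, j} = {1, 2}"
      "n + 2 - j = n + 2 - i + 1 \<longleftrightarrow> i = j + 1" "n + 2 - i = n + 2 - j + 1 \<longleftrightarrow> j = i + 1"
      using that by (auto simp: doubleton_eq_iff)
    then show ?thesis
      by (simp add: typeB_def typeB'_def disj_commute)
  qed
qed

theorem theorem4p4:
  fixes n :: nat
  assumes "n \<ge> 2"
  shows
    "(\<forall>w. fully_commutative (typeB n) w \<longrightarrow>
        (non_cancellable (typeB n) w \<longleftrightarrow>
           commuting_product (typeB n) w \<or>
           (\<exists>u. commuting_product (typeB n) u \<and>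
                1 \<notin> supp (typeB n) u \<and> 2 \<notin> supp (typeB n) u \<and> 3 \<notin> supp (typeB n) u \<and>
                (w = gen (typeB n) 1 \<otimes>\<^bsub>cox_group (typeB n)\<^esub> gen (typeB n) 2
                       \<otimes>\<^bsub>cox_group (typeB n)\<^esub> u \<or>
                 w = gen (typeB n) 2 \<otimes>\<^bsub>cox_group (typeB n)\<^esub> gen (typeB n) 1
                       \<otimes>\<^bsub>cox_group (typeB n)\<^esub> u)))) \<and>
     (\<forall>w. fully_commutative (typeB' n) w \<longrightarrow>
        (non_cancellable (typeB' n) w \<longleftrightarrow>
           commuting_product (typeB' n) w \<or>
           (\<exists>u. commuting_product (typeB' n) u \<and>
                n + 1 \<notin> supp (typeB' n) u \<and> n \<notin> supp (typeB' n) u \<and> n - 1 \<notin> supp (typeB' n) u \<and>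
                (w = gen (typeB' n) (n + 1) \<otimes>\<^bsub>cox_group (typeB' n)\<^esub> gen (typeB' n) n
                       \<otimes>\<^bsub>cox_group (typeB' n)\<^esub> u \<or>
                 w = gen (typeB' n) n \<otimes>\<^bsub>cox_group (typeB' n)\<^esub> gen (typeB' n) (n + 1)
                       \<otimes>\<^bsub>cox_group (typeB' n)\<^esub> u))))"
proof -
  interpret B: labelled_typeB "typeB n" n "\<lambda>i. i"
    using assms by (rule labelled_typeB)
  interpret B': labelled_typeB "typeB' n" n "\<lambda>i. n + 2 - i"
    using assms by (rule labelled_typeB')
  have "n + 2 - 1 = n + 1" "n + 2 - 2 = n" "n + 2 - 3 = n - 1"
    by auto
  note B'.non_cancellable_classification[unfolded B'.bond4_product_def this]
  then show ?thesis
    using B.non_cancellable_classification[unfolded B.bond4_product_def] by blast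
qed

end
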